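(* Let $P,Q$ be two probability distributions over the same finite set $\mathcal{X}$. (1) If $D(Q\|P) < \infty$, then there is a $P$ to $Q$ simulator $I$ such that $$\mathbb{E}[\log_2 I] \leq D(Q\|P) + 1.45\, \|Q-P\|_1 .$$ (2) For every $P$ to $Q$ simulator $I$, $$\mathbb{E}[\log_2 I] \geq \frac{1}{2} \max\{ D(Q\|P),\ \|Q-P\|_1 \}.$$ (3) In particular, if $D(Q\|P)=\infty$, then there is no $P$ to $Q$ simulator.
   Context: For probability distributions $P,Q$ on a finite set $\mathcal{X}$: the Kullback–Leibler divergence is $D(Q\|P) = \sum_{x} Q(x)\log_2 \frac{Q(x)}{P(x)}$ (logarithm in base two), with the usual conventions that terms with $Q(x)=0$ contribute $0$ and that $D(Q\|P)=\infty$ if there is $x$ with $Q(x)>0$ and $P(x)=0$. Also $\|Q-P\|_1 = \sum_x |Q(x)-P(x)|$. A $P$ to $Q$ simulator is a random index $I$ with values in $\{1,2,\ldots\}$, defined on a common probability space with an infinite sequence $X_1,X_2,\ldots$ of i.i.d. samples from $P$, such that $X_I \sim Q$, i.e. $\Pr[X_I = x] = Q(x)$ for every $x\in\mathcal{X}$. The index $I$ may depend on the entire sequence $(X_i)_{i\ge 1}$ and may also use additional randomness. The expectation $\mathbb{E}[\log_2 I]$ takes values in $[0,\infty]$. *)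

theory Defs
  imports "HOL-Probability.Probability"
begin

definition kl_div :: "'a set \<Rightarrow> 'a pmf \<Rightarrow> 'a pmf \<Rightarrow> ereal" where
  "kl_div A Q P =
     (if \<exists>x\<in>A. pmf Q x > 0 \<and> pmf P x = 0 then \<infinity>
      else ereal (\<Sum>x\<in>A. if pmf Q x = 0 then 0 else pmf Q x * log 2 (pmf Q x / pmf P x)))"

definition l1_dist :: "'a set \<Rightarrow> 'a pmf \<Rightarrow> 'a pmf \<Rightarrow> real" where
  "l1_dist A Q P = (\<Sum>x\<in>A. \<bar>pmf Q x - pmf P x\<bar>)"

text \<open>
  The sequence is \<open>X 1, X 2, \<dots>\<close>; the value \<open>X 0\<close> is never used. Measurability of each \<open>X i\<close>, as a
  random variable with values in \<open>A\<close>, is part of \<open>indep_vars\<close>. The index \<open>J\<close> is an arbitrary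
  random variable on the same space, so it may depend on the whole sequence and on further
  randomness.
\<close>

definition simulator ::
  "'a set \<Rightarrow> 'a pmf \<Rightarrow> 'a pmf \<Rightarrow> 'w measure \<Rightarrow> (nat \<Rightarrow> 'w \<Rightarrow> 'a) \<Rightarrow> ('w \<Rightarrow> nat) \<Rightarrow> bool" where
  "simulator A P Q M X J \<longleftrightarrow>
     prob_space M \<and>
     prob_space.indep_vars M (\<lambda>_. count_space A) X {1..} \<and>
     (\<forall>i\<ge>1. \<forall>x\<in>A. measure M {\<omega> \<in> space M. X i \<omega> = x} = pmf P x) \<and>
     J \<in> measurable M (count_space UNIV) \<and>
     (\<forall>\<omega>\<in>space M. J \<omega> \<ge> 1) \<and>
     (\<forall>x\<in>A. measure M {\<omega> \<in> space M. X (J \<omega>) \<omega> = x} = pmf Q x)"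

definition expected_log :: "'w measure \<Rightarrow> ('w \<Rightarrow> nat) \<Rightarrow> ereal" where
  "expected_log M J = enn2ereal (\<integral>\<^sup>+ \<omega>. ennreal (log 2 (real (J \<omega>))) \<partial>M)"

end

theory Submission
  imports Defs
begin

text \<open>
  Lower bounds. \<open>X\<^sub>J\<close> and \<open>X\<^sub>1\<close> differ with probability at least half the \<open>L\<^sub>1\<close>-distance, and
  \<open>log\<^sub>2 J \<ge> 1\<close> when \<open>J \<noteq> 1\<close>. Since \<open>Pr[J = i, X\<^sub>J = x] \<le> P x\<close>, the contribution of \<open>x\<close> to the expected
  logarithm is least when \<open>J\<close> is spread evenly over \<open>1, \<dots>, r\<close> with \<open>r = Q x / P x\<close>, where it is
  at least \<open>Q x / 2 \<cdot> log\<^sub>2 r\<close> because \<open>(m!)\<^sup>2 \<ge> m\<^sup>m\<close>.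

  Upper bound. Give the i.i.d. samples \<open>Y\<^sub>j\<close>, \<open>j < n\<close>, independent uniform arrival times \<open>t\<^sub>j\<close>, list them in order of
  arrival, and select the one with the least score \<open>u = t\<^sub>j / r(Y\<^sub>j)\<close>, where \<open>r = Q / P\<close>. As long as
  \<open>u \<le> 1 / max r\<close>, the score has density \<open>Q(y)\<close> at value \<open>y\<close>, so the selected value has law \<open>Q\<close>. Given that
  \<open>y\<close> is selected, on average \<open>c(y) = \<Sum>\<^sub>z (P z \<cdot> r y - Q z)\<^sup>+\<close> samples arrived earlier, hence
  \<open>E[log\<^sub>2 J] \<le> \<Sum>\<^sub>y Q y \<cdot> log\<^sub>2 (1 + c y) \<le> D(Q || P) + log\<^sub>2 e \<cdot> L\<^sub>1(Q, P)\<close> by Jensen. If no score is small enough,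
  plain rejection sampling on the later samples takes over; its cost vanishes as \<open>n\<close> grows and is
  absorbed by \<open>1.45 > log\<^sub>2 e\<close>.
\<close>

section \<open>Lower bounds\<close>

text \<open>Pair the factor i + 1 of one factorial with m - i of the other: (i + 1)(m - i) - m = i(m
  - i - 1) \<ge> 0, so each of the m products is at least m.\<close>

lemma power_self_le_fact_square: "m ^ m \<le> (fact m :: nat)\<^sup>2"
proof -
  have *: "m \<le> Suc i * (m - i)" if im: "i < m" for i
  proof -
    obtain d where "m = Suc (i + d)" using less_imp_Suc_add[OF im] by blast
    then show ?thesis by simp
  qed
  have f: "fact m = (\<Prod>i<m. Suc i)"
    by (simp add: fact_prod_Suc atLeast0LessThan)
  have g: "fact m = (\<Prod>i<m. m - i)"
    by (simp add: fact_prod_rev atLeast0LessThan)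
  have "m ^ m = (\<Prod>i<m. m)" by simp
  also have "\<dots> \<le> (\<Prod>i<m. Suc i * (m - i))"
    by (rule prod_mono) (use * in auto)
  also have "\<dots> = (fact m)\<^sup>2"
    by (simp only: prod.distrib f[symmetric] g[symmetric] power2_eq_square)
  finally show ?thesis .
qed

lemma convex_on_mult_ln: "convex_on {0<..} (\<lambda>x::real. x * ln x)"
proof (rule f''_ge0_imp_convex)
  show "convex {0::real<..}" by simp
  show "DERIV (\<lambda>x. x * ln x) x :> ln x + 1" if "x \<in> {0<..}" for x :: real
    using that by (auto intro!: derivative_eq_intros)
  show "DERIV (\<lambda>x. ln x + 1) x :> 1 / x" if "x \<in> {0<..}" for x :: real
    using that by (auto intro!: derivative_eq_intros)
  show "0 \<le> 1 / x" if "x \<in> {0<..}" for x :: real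
    using that by auto
qed

text \<open>The right-hand side is the least cost of placing mass r on positions 1, 2, ... with at
  most 1 on each. It interpolates ln m! and ln (m + 1)! linearly, while x ln x is convex and lies
  below its chord; at integers the factorial bound applies. For m = 0 the chord would start at 0,
  outside the domain of convexity, but there r ln r \<le> 0.\<close>

lemma half_mult_ln_le_ln_fact:
  fixes r :: real and m :: nat
  assumes "m \<le> r" "r \<le> m + 1"
  shows "r / 2 * ln r \<le> (r - m) * ln (m + 1) + (\<Sum>i=1..m. ln (real i))"
proof (cases "m = 0")
  case True
  then have "r * ln r \<le> 0" using assms
    by (cases "r = 0") (auto simp: mult_le_0_iff)
  then show ?thesis using True by simp
next
  case False
  have lnf: "(\<Sum>i=1..k. ln (real i)) = ln (fact k)" for k
    by (induction k) (auto simp: ln_mult add.commute)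
  have half: "k * ln k / 2 \<le> ln (fact k)" if "k > 0" for k :: nat
  proof -
    have "real k ^ k \<le> (fact k)\<^sup>2"
      using power_self_le_fact_square[of k]
      by (metis (mono_tags) of_nat_fact of_nat_le_iff of_nat_power)
    then have "ln (real k ^ k) \<le> ln ((fact k)\<^sup>2)" using that by (intro ln_mono) auto
    then show ?thesis using that by (simp add: ln_realpow)
  qed
  define s where "s = r - m"
  have s: "0 \<le> s" "s \<le> 1" using assms by (auto simp: s_def)
  have r: "r = (1 - s) * real m + s * real (m + 1)" by (simp add: s_def algebra_simps)
  have "r * ln r \<le> (1 - s) * (m * ln m) + s * (real (m + 1) * ln (real (m + 1)))"
    using convex_onD[OF convex_on_mult_ln s, of "real m" "real (m+1)"] False r
    by (simp add: algebra_simps)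
  also have "\<dots> \<le> (1 - s) * (2 * ln (fact m)) + s * (2 * ln (fact (m + 1)))"
    using half[of m] half[of "m + 1"] False s
    by (intro add_mono mult_left_mono) auto
  also have "\<dots> = 2 * (s * ln (m + 1) + ln (fact m))"
    using ln_mult[of "1 + real m" "fact m"] by (simp add: algebra_simps)
  finally show ?thesis unfolding lnf s_def by simp
qed

section \<open>Constraints on an arbitrary simulator\<close>

locale simulation =
  fixes A :: "'a set" and P Q :: "'a pmf" and M :: "'w measure" and X J
  assumes finA: "finite A" and sim: "simulator A P Q M X J"
begin

sublocale prob_space M using sim by (simp add: simulator_def)

lemma X_measurable: "i \<ge> 1 \<Longrightarrow> X i \<in> measurable M (count_space A)"
  using sim by (auto simp: simulator_def indep_vars_def)

lemma J_measurable [measurable]: "J \<in> measurable M (count_space UNIV)"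
  using sim by (auto simp: simulator_def)

lemma J_ge_1: "\<omega> \<in> space M \<Longrightarrow> J \<omega> \<ge> 1"
  using sim by (auto simp: simulator_def)

lemma hit_event: "i \<ge> 1 \<Longrightarrow> {\<omega>\<in>space M. X i \<omega> = x} \<in> events"
proof (cases "x \<in> A")
  case True
  assume "i \<ge> 1"
  from measurable_sets[OF X_measurable[OF this], of "{x}"] True
  show ?thesis by (auto simp: vimage_def Int_def conj_commute)
next
  case False
  assume "i \<ge> 1"
  from measurable_space[OF X_measurable[OF this]] False
  have "{\<omega>\<in>space M. X i \<omega> = x} = {}" by auto
  then show ?thesis by (simp only: sets.empty_sets)
qed

lemma prob_hit: "i \<ge> 1 \<Longrightarrow> x \<in> A \<Longrightarrow> prob {\<omega>\<in>space M. X i \<omega> = x} = pmf P x"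
  using sim by (auto simp: simulator_def)

definition out where "out x = {\<omega>\<in>space M. X (J \<omega>) \<omega> = x}"

lemma prob_out: "x \<in> A \<Longrightarrow> prob (out x) = pmf Q x"
  using sim by (auto simp: simulator_def out_def)

lemma J_event [measurable]: "{\<omega>\<in>space M. J \<omega> = i} \<in> events"
  by measurable

lemma out_event: "out x \<in> events"
proof -
  \<comment> \<open>The union over values of \<open>J\<close> starts at 1, since \<open>X 0\<close>
    need not be measurable.\<close>
  have "out x = (\<Union>i\<in>{1..}. {\<omega>\<in>space M. J \<omega> = i} \<inter> {\<omega>\<in>space M. X i \<omega> = x})"
    using J_ge_1 by (auto simp: out_def)
  also have "\<dots> \<in> events"
    by (intro sets.countable_UN' ballI image_subsetI sets.Int hit_event J_event) auto
  finally show ?thesis .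
qed

text \<open>On this event \<open>X i\<close> equals x, however \<open>J\<close> depends on the
  sequence. This cap drives both lower bounds.\<close>

lemma prob_out_at: "i \<ge> 1 \<Longrightarrow> x \<in> A \<Longrightarrow> prob (out x \<inter> {\<omega>\<in>space M. J \<omega> = i}) \<le> pmf P x"
  using finite_measure_mono[of "out x \<inter> {\<omega>\<in>space M. J \<omega> = i}" "{\<omega>\<in>space M. X i \<omega> = x}"]
    prob_hit[of i x] hit_event[of i x]
  by (auto simp: out_def)

text \<open>The output x requires \<open>X i\<close> = x for some i \<ge> 1, a countable union of
  null events. This already excludes infinite divergence.\<close>

lemma Q_absolutely_continuous:
  assumes "x \<in> A" "pmf P x = 0"
  shows "pmf Q x = 0"
proof -
  have "(\<Union>i\<in>{1..}. {\<omega>\<in>space M. X i \<omega> = x}) \<in> null_sets M"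
    using prob_hit[OF _ assms(1)] assms(2) hit_event
    by (intro null_sets_UN') (auto simp: emeasure_eq_measure null_sets_def)
  then have "out x \<in> null_sets M"
    by (rule null_sets_subset[OF _ out_event]) (use J_ge_1 in \<open>auto simp: out_def\<close>)
  then show ?thesis using prob_out[OF assms(1)] by (simp add: measure_eq_0_null_sets)
qed

lemma kl_div_finite: "kl_div A Q P \<noteq> \<infinity>"
proof -
  have "\<not> (\<exists>x\<in>A. pmf Q x > 0 \<and> pmf P x = 0)"
    using Q_absolutely_continuous by (metis less_irrefl)
  then show ?thesis by (simp add: kl_div_def)
qed

text \<open>Lets a real minorant that may be negative be compared with the nonnegative integral in
  \<open>expected_log\<close>: clipping at 0 only increases it and keeps it below the logarithm,
  because \<open>J\<close> \<ge> 1.\<close>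

lemma integral_le_expected_log:
  assumes "integrable M f" "\<And>\<omega>. \<omega> \<in> space M \<Longrightarrow> f \<omega> \<le> log 2 (J \<omega>)"
  shows "ereal (\<integral>\<omega>. f \<omega> \<partial>M) \<le> expected_log M J"
proof -
  have "ereal (\<integral>\<omega>. f \<omega> \<partial>M) \<le> ereal (\<integral>\<omega>. max 0 (f \<omega>) \<partial>M)"
    using assms(1) by (auto intro!: integral_mono)
  also have "\<dots> = enn2ereal (\<integral>\<^sup>+\<omega>. ennreal (max 0 (f \<omega>)) \<partial>M)"
    using assms(1) by (subst nn_integral_eq_integral) (auto simp: enn2ereal_ennreal)
  also have "\<dots> \<le> expected_log M J"
    unfolding expected_log_def less_eq_ennreal.rep_eq[symmetric]
    using assms(2) J_ge_1 by (intro nn_integral_mono ennreal_leI) (auto simp: Suc_le_eq)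
  finally show ?thesis .
qed

lemma half_l1_dist_le_expected_log:
  assumes "set_pmf P \<subseteq> A" "set_pmf Q \<subseteq> A"
  shows "ereal (l1_dist A Q P / 2) \<le> expected_log M J"
proof -
  let ?f = "indicator {\<omega>\<in>space M. J \<omega> \<noteq> 1} :: _ \<Rightarrow> real"
  let ?B = "{x\<in>A. pmf Q x > pmf P x}"
  have sums: "(\<Sum>x\<in>A. pmf Q x) = 1" "(\<Sum>x\<in>A. pmf P x) = 1"
    using assms finA by (auto intro!: sum_pmf_eq_1)
  \<comment> \<open>|a| = 2 max(0, a) - a, and the differences Q x - P x sum to 0.\<close>
  have "l1_dist A Q P = (\<Sum>x\<in>A. 2 * max 0 (pmf Q x - pmf P x) - (pmf Q x - pmf P x))"
    unfolding l1_dist_def by (intro sum.cong refl) (simp add: max_def)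
  also have "\<dots> = 2 * (\<Sum>x\<in>A. max 0 (pmf Q x - pmf P x))"
    using sums by (simp add: sum_subtractf sum_distrib_left)
  also have "(\<Sum>x\<in>A. max 0 (pmf Q x - pmf P x)) = (\<Sum>x\<in>?B. pmf Q x - pmf P x)"
    using finA by (intro sum.mono_neutral_cong_right) auto
  \<comment> \<open>With \<open>J\<close> = 1 the value x is output with probability at most P x, so
    the excess of Q x must come from \<open>J\<close> \<noteq> 1.\<close>
  also have "\<dots> \<le> (\<Sum>x\<in>?B. prob (out x \<inter> {\<omega>\<in>space M. J \<omega> \<noteq> 1}))"
  proof (rule sum_mono)
    fix x assume "x \<in> ?B"
    then have x: "x \<in> A" by simp
    have "pmf Q x = prob (out x)" using prob_out x by simp
    also have "\<dots> \<le> prob (out x \<inter> {\<omega>\<in>space M. J \<omega> = 1} \<union> out x \<inter> {\<omega>\<in>space M. J \<omega> \<noteq> 1})"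
      using out_event by (intro finite_measure_mono) (auto simp: out_def)
    also have "\<dots> \<le> prob (out x \<inter> {\<omega>\<in>space M. J \<omega> = 1}) + prob (out x \<inter> {\<omega>\<in>space M. J \<omega> \<noteq> 1})"
      using out_event by (intro measure_Un_le) auto
    also have "\<dots> \<le> pmf P x + prob (out x \<inter> {\<omega>\<in>space M. J \<omega> \<noteq> 1})"
      using prob_out_at[of 1 x] x by simp
    finally show "pmf Q x - pmf P x \<le> prob (out x \<inter> {\<omega>\<in>space M. J \<omega> \<noteq> 1})" by simp
  qed
  also have "\<dots> = prob (\<Union>x\<in>?B. out x \<inter> {\<omega>\<in>space M. J \<omega> \<noteq> 1})"
    using finA out_event
    by (intro finite_measure_finite_Union[symmetric]) (auto simp: disjoint_family_on_def out_def)
  also have "\<dots> \<le> prob {\<omega>\<in>space M. J \<omega> \<noteq> 1}"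
    by (intro finite_measure_mono) auto
  finally have "l1_dist A Q P / 2 \<le> (\<integral>\<omega>. ?f \<omega> \<partial>M)" by simp
  also have "ereal (\<integral>\<omega>. ?f \<omega> \<partial>M) \<le> expected_log M J"
  proof (rule integral_le_expected_log)
    fix \<omega> assume "\<omega> \<in> space M"
    with J_ge_1[OF this] show "?f \<omega> \<le> log 2 (J \<omega>)"
      by (auto simp: indicator_def le_log_iff)
  qed (auto simp: emeasure_eq_measure)
  finally show ?thesis by simp
qed

lemma half_kl_div_le_expected_log:
  "ereal (1 / 2) * kl_div A Q P \<le> expected_log M J"
proof -
  define r where "r x = pmf Q x / pmf P x" for x
  define m where "m x = nat \<lfloor>r x\<rfloor>" for x
  define l where "l x = log 2 (m x + 1)" for x
  \<comment> \<open>A dual certificate: where x is output, \<open>f\<close> equals the base two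
    logarithm of min(\<open>J\<close>, \<open>m x\<close> + 1). In this form Pr[J = i, X_J = x]
    enters with the nonpositive coefficient log i - log (m + 1), so replacing it by its cap P x can
    only lower the integral.\<close>
  define f where "f \<omega> = (\<Sum>x\<in>A. l x * indicator (out x) \<omega>
     - (\<Sum>i=1..m x. (l x - log 2 i) * indicator (out x \<inter> {\<omega>\<in>space M. J \<omega> = i}) \<omega>))" for \<omega>
  have r0: "r x \<ge> 0" for x by (simp add: r_def)
  have m: "m x \<le> r x" "r x \<le> m x + 1" for x
    using r0[of x] unfolding m_def by linarith+
  have hbi: "has_bochner_integral M f (\<Sum>x\<in>A. l x * prob (out x)
     - (\<Sum>i=1..m x. (l x - log 2 i) * prob (out x \<inter> {\<omega>\<in>space M. J \<omega> = i})))"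
    unfolding f_def
    by (intro has_bochner_integral_sum has_bochner_integral_diff
          has_bochner_integral_mult_right has_bochner_integral_real_indicator sets.Int out_event J_event)
       (auto simp: emeasure_eq_measure)
  have le: "f \<omega> \<le> log 2 (J \<omega>)" if w: "\<omega> \<in> space M" for \<omega>
  proof -
    define y where "y = X (J \<omega>) \<omega>"
    have y: "y \<in> A" using J_ge_1[OF w] measurable_space[OF X_measurable w] y_def by auto
    have "f \<omega> = (\<Sum>x\<in>{y}. l x * indicator (out x) \<omega>
     - (\<Sum>i=1..m x. (l x - log 2 i) * indicator (out x \<inter> {\<omega>\<in>space M. J \<omega> = i}) \<omega>))"
      unfolding f_def using y finA
      by (intro sum.mono_neutral_right) (auto simp: out_def y_def indicator_def)
    also have "\<dots> = l y - (\<Sum>i=1..m y. if i = J \<omega> then l y - log 2 i else 0)"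
    proof -
      have "(\<Sum>i=1..m y. (l y - log 2 i) * indicator (out y \<inter> {\<omega>\<in>space M. J \<omega> = i}) \<omega>)
         = (\<Sum>i=1..m y. if i = J \<omega> then l y - log 2 i else 0)"
        using w by (intro sum.cong refl) (auto simp: out_def y_def indicator_def)
      then show ?thesis using w by (simp add: out_def y_def)
    qed
    also have "\<dots> = l y - (if J \<omega> \<le> m y then l y - log 2 (J \<omega>) else 0)"
      using J_ge_1[OF w] by (simp add: sum.delta)
    also have "\<dots> \<le> log 2 (J \<omega>)" by (auto simp: l_def)
    finally show ?thesis .
  qed
  have "(1/2) * (\<Sum>x\<in>A. if pmf Q x = 0 then 0 else pmf Q x * log 2 (pmf Q x / pmf P x))
      \<le> (\<Sum>x\<in>A. l x * pmf Q x - (\<Sum>i=1..m x. (l x - log 2 i) * pmf P x))"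
    unfolding sum_distrib_left
  proof (rule sum_mono)
    fix x assume x: "x \<in> A"
    show "1 / 2 * (if pmf Q x = 0 then 0 else pmf Q x * log 2 (pmf Q x / pmf P x))
         \<le> l x * pmf Q x - (\<Sum>i=1..m x. (l x - log 2 i) * pmf P x)"
    proof (cases "pmf P x = 0")
      case True
      then show ?thesis using Q_absolutely_continuous x by simp
    next
      case False
      have Q: "pmf Q x = r x * pmf P x" using False by (simp add: r_def)
      \<comment> \<open>With P x factored out, the claim is \<open>half_mult_ln_le_ln_fact\<close>
        at \<open>r x\<close>, in base two.\<close>
      have "1 / 2 * (if pmf Q x = 0 then 0 else pmf Q x * log 2 (pmf Q x / pmf P x))
         = pmf P x * ((r x / 2 * ln (r x)) / ln 2)"
        using False by (auto simp: r_def log_def)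
      also have "\<dots> \<le> pmf P x * (((r x - m x) * ln (m x + 1) + (\<Sum>i=1..m x. ln (real i))) / ln 2)"
        using half_mult_ln_le_ln_fact[OF m[of x]]
        by (intro mult_left_mono divide_right_mono) auto
      also have "\<dots> = pmf P x * (r x * l x - (\<Sum>i=1..m x. (l x - log 2 i)))"
        by (simp add: l_def log_def sum_subtractf sum_divide_distrib[symmetric])
           (simp add: field_simps)
      also have "\<dots> = l x * pmf Q x - (\<Sum>i=1..m x. (l x - log 2 i) * pmf P x)"
        by (simp only: Q sum_distrib_right[symmetric]) (simp add: right_diff_distrib mult_ac)
      finally show ?thesis .
    qed
  qed
  also have "\<dots> \<le> (\<Sum>x\<in>A. l x * prob (out x)
     - (\<Sum>i=1..m x. (l x - log 2 i) * prob (out x \<inter> {\<omega>\<in>space M. J \<omega> = i})))"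
    using prob_out prob_out_at
    by (intro sum_mono diff_mono mult_left_mono) (auto simp: l_def)
  also have "\<dots> = (\<integral>\<omega>. f \<omega> \<partial>M)"
    using hbi by (rule has_bochner_integral_integral_eq[symmetric])
  finally have "ereal ((1/2) * (\<Sum>x\<in>A. if pmf Q x = 0 then 0 else pmf Q x * log 2 (pmf Q x / pmf P x)))
     \<le> ereal (\<integral>\<omega>. f \<omega> \<partial>M)" by simp
  also have "\<dots> \<le> expected_log M J" by (rule integral_le_expected_log[OF integrable.intros[OF hbi] le])
  finally show ?thesis
    using kl_div_finite by (auto simp: kl_div_def split: if_splits)
qed

end

section \<open>The divergence bound\<close>

text \<open>20/29 is the reciprocal of 1.45. The strict gap pays for the rejection sampling
  tail.\<close>

lemma inverse_ln_2_less: "1 / ln 2 < (1.45::real)"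
proof -
  have "ln 2 > (20/29 :: real)"
    using ln_approx_bounds[of 2 3] by (simp add: eval_nat_numeral)
  then show ?thesis by (simp add: field_simps)
qed

text \<open>The mean number of earlier arrivals, given that \<open>y\<close> is selected.\<close>

definition overtaken :: "'a set \<Rightarrow> 'a pmf \<Rightarrow> 'a pmf \<Rightarrow> 'a \<Rightarrow> real" where
  "overtaken A P Q y = (\<Sum>z\<in>A. max 0 (pmf P z * (pmf Q y / pmf P y) - pmf Q z))"

lemma overtaken_nonneg: "overtaken A P Q y \<ge> 0"
  unfolding overtaken_def by (intro sum_nonneg) auto

text \<open>\<open>d\<close> is half the L1 distance. Each y may exceed its divergence term by d P y
  + (P y - Q y)^+, and these errors sum to 2d. For r \<ge> 1 one has c \<le> r - 1 + d, so ln (1 +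
  c) \<le> ln r + d / r, and Q y / r = P y. For r < 1 one has ln (1 + c) \<le> c \<le> d, and the
  negative ln r is charged to P y - Q y.\<close>

lemma sum_log_overtaken_le:
  assumes "finite A" "set_pmf P \<subseteq> A" "set_pmf Q \<subseteq> A"
    and ac: "\<And>x. x \<in> A \<Longrightarrow> pmf P x = 0 \<Longrightarrow> pmf Q x = 0"
  shows "(\<Sum>y\<in>A. pmf Q y * ln (1 + overtaken A P Q y)) \<le>
    (\<Sum>y\<in>A. if pmf Q y = 0 then 0 else pmf Q y * ln (pmf Q y / pmf P y)) + l1_dist A Q P"
proof -
  define d where "d = (\<Sum>z\<in>A. max 0 (pmf Q z - pmf P z))"
  have sums: "(\<Sum>x\<in>A. pmf Q x) = 1" "(\<Sum>x\<in>A. pmf P x) = 1"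
    using assms by (auto intro!: sum_pmf_eq_1)
  have d0: "d \<ge> 0" unfolding d_def by (intro sum_nonneg) auto
  have d': "(\<Sum>z\<in>A. max 0 (pmf P z - pmf Q z)) = d"
  proof -
    have "(\<Sum>z\<in>A. max 0 (pmf P z - pmf Q z)) = (\<Sum>z\<in>A. max 0 (pmf Q z - pmf P z) + (pmf P z - pmf Q z))"
      by (intro sum.cong) auto
    then show ?thesis using sums by (simp add: d_def sum.distrib sum_subtractf)
  qed
  have l1: "l1_dist A Q P = 2 * d"
  proof -
    have "l1_dist A Q P = (\<Sum>x\<in>A. max 0 (pmf Q x - pmf P x) + max 0 (pmf P x - pmf Q x))"
      unfolding l1_dist_def by (intro sum.cong) auto
    then show ?thesis using d' by (simp add: d_def sum.distrib)
  qed
  have "pmf Q y * ln (1 + overtaken A P Q y) \<le>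
    (if pmf Q y = 0 then 0 else pmf Q y * ln (pmf Q y / pmf P y)) + d * pmf P y + max 0 (pmf P y - pmf Q y)"
    if y: "y \<in> A" for y
  proof (cases "pmf Q y = 0")
    case True
    then show ?thesis using d0 by simp
  next
    case False
    then have P0: "pmf P y > 0" using ac[OF y] by (auto simp: pmf_nonneg less_le)
    have Q0: "pmf Q y > 0" using False by (simp add: pmf_nonneg less_le)
    define r where "r = pmf Q y / pmf P y"
    have r0: "r > 0" using P0 Q0 by (simp add: r_def)
    have Q: "pmf Q y = r * pmf P y" using P0 by (simp add: r_def)
    let ?c = "overtaken A P Q y"
    have c: "?c = (\<Sum>z\<in>A. max 0 (pmf P z * r - pmf Q z))" by (simp add: overtaken_def r_def)
    have c0: "?c \<ge> 0" by (rule overtaken_nonneg)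
    show ?thesis
    proof (cases "r \<ge> 1")
      case True
      \<comment> \<open>The positive part of rP - Q is rP - Q plus the positive part of Q - rP,
        which is at most that of Q - P as r \<ge> 1.\<close>
      have "?c \<le> (\<Sum>z\<in>A. max 0 (pmf Q z - pmf P z) + (pmf P z * r - pmf Q z))"
        unfolding c
      proof (rule sum_mono)
        fix z
        have "pmf P z * r \<ge> pmf P z * 1" using True by (intro mult_left_mono) auto
        then show "max 0 (pmf P z * r - pmf Q z) \<le> max 0 (pmf Q z - pmf P z) + (pmf P z * r - pmf Q z)"
          by auto
      qed
      also have "\<dots> = d + r - 1"
        using sums by (simp add: d_def sum.distrib sum_subtractf sum_distrib_right[symmetric])
      finally have "ln (1 + ?c) \<le> ln (r + d)" using c0 by (intro ln_mono) auto
      also have "r + d = r * (1 + d / r)" using r0 by (simp add: field_simps)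
      also have "ln \<dots> = ln r + ln (1 + d / r)" using r0 d0 by (intro ln_mult_pos) (auto intro: add_pos_nonneg)
      also have "\<dots> \<le> ln r + d / r" using r0 d0 by (simp add: ln_add_one_self_le_self)
      finally have "pmf Q y * ln (1 + ?c) \<le> pmf Q y * (ln r + d / r)"
        by (intro mult_left_mono) auto
      also have "\<dots> = pmf Q y * ln r + d * pmf P y"
        using r0 by (simp add: Q algebra_simps)
      finally show ?thesis using False by (simp add: r_def)
    next
      case False
      then have r1: "r < 1" by simp
      \<comment> \<open>Here r < 1 gives rP - Q \<le> r(P - Q).\<close>
      have "?c \<le> (\<Sum>z\<in>A. max 0 (pmf P z - pmf Q z) * r)"
        unfolding c
      proof (rule sum_mono)
        fix z
        have "pmf Q z * r \<le> pmf Q z * 1" using r1 by (intro mult_left_mono) auto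
        moreover have "(pmf P z - pmf Q z) * r \<le> max 0 (pmf P z - pmf Q z) * r"
          using r0 by (intro mult_right_mono) auto
        ultimately show "max 0 (pmf P z * r - pmf Q z) \<le> max 0 (pmf P z - pmf Q z) * r"
          using r0 by (auto simp: algebra_simps)
      qed
      also have "\<dots> = d * r" using d' by (simp add: sum_distrib_right[symmetric])
      also have "\<dots> \<le> d" using r1 d0 by (simp add: mult_left_le)
      finally have cd: "?c \<le> d" .
      have "ln (1 + ?c) \<le> ?c" using c0 by (rule ln_add_one_self_le_self)
      with cd have "pmf Q y * ln (1 + ?c) \<le> pmf Q y * d" by (intro mult_left_mono) auto
      also have "\<dots> \<le> d * pmf P y"
        using r1 d0 P0 mult_right_mono[of r 1 "pmf P y"] by (simp add: Q mult_left_mono mult.commute)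
      finally have 1: "pmf Q y * ln (1 + ?c) \<le> d * pmf P y" .
      have "ln (1 / r) \<le> 1 / r - 1" using r0 by (intro ln_le_minus_one) auto
      then have "pmf Q y * - ln r \<le> pmf Q y * (1 / r - 1)"
        using r0 by (intro mult_left_mono) (auto simp: ln_div)
      also have "\<dots> = pmf P y - pmf Q y" using r0 by (simp add: Q algebra_simps)
      finally show ?thesis using 1 Q0 unfolding r_def by (auto simp: not_less)
    qed
  qed
  then have "(\<Sum>y\<in>A. pmf Q y * ln (1 + overtaken A P Q y)) \<le> (\<Sum>y\<in>A.
    (if pmf Q y = 0 then 0 else pmf Q y * ln (pmf Q y / pmf P y)) + d * pmf P y + max 0 (pmf P y - pmf Q y))"
    by (rule sum_mono)
  also have "\<dots> = (\<Sum>y\<in>A. if pmf Q y = 0 then 0 else pmf Q y * ln (pmf Q y / pmf P y)) + l1_dist A Q P"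
    using sums d' l1 by (simp add: sum.distrib sum_distrib_left[symmetric])
  finally show ?thesis .
qed

section \<open>Product measures and uniform arrival times\<close>

text \<open>Condition on coordinate \<open>j\<close>: given its value z, the factors involve
  distinct independent coordinates, so the mean of their product is the product of their means. The
  infinite product is first projected to the finitely many coordinates involved.\<close>

lemma nn_integral_PiM_pairwise_prod:
  fixes h :: "'b \<Rightarrow> ennreal" and g :: "nat \<Rightarrow> 'b \<Rightarrow> 'b \<Rightarrow> ennreal"
  assumes N: "prob_space N" and K: "finite K" "j \<notin> K"
    and h [measurable]: "h \<in> borel_measurable N"
    and g: "\<And>k. k \<in> K \<Longrightarrow> (\<lambda>(z, w). g k z w) \<in> borel_measurable (N \<Otimes>\<^sub>M N)"
  shows "(\<integral>\<^sup>+\<omega>. h (\<omega> j) * (\<Prod>k\<in>K. g k (\<omega> j) (\<omega> k)) \<partial>(\<Pi>\<^sub>M i\<in>UNIV. N)) =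
    (\<integral>\<^sup>+z. h z * (\<Prod>k\<in>K. \<integral>\<^sup>+w. g k z w \<partial>N) \<partial>N)"
proof -
  interpret N: prob_space N by fact
  interpret pps: product_prob_space "\<lambda>_::nat. N" UNIV ..
  let ?F = "\<lambda>\<omega>. h (\<omega> j) * (\<Prod>k\<in>K. g k (\<omega> j) (\<omega> k))"
  let ?S = "\<Pi>\<^sub>M i\<in>insert j K. N"
  have g': "(\<lambda>x. g k (a x) (b x)) \<in> borel_measurable L"
    if "k \<in> K" "a \<in> measurable L N" "b \<in> measurable L N" for k a b and L :: "'b measure"
    using measurable_compose[OF measurable_Pair[OF that(2,3)] g[OF that(1)]] by simp
  have F: "?F \<in> borel_measurable ?S"
  proof (intro borel_measurable_times_ennreal borel_measurable_prod_ennreal)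
    show "(\<lambda>\<omega>. h (\<omega> j)) \<in> borel_measurable ?S"
      using measurable_compose[OF measurable_component_singleton[of j "insert j K" "\<lambda>_. N"] h] by simp
    fix k assume "k \<in> K"
    show "(\<lambda>\<omega>. g k (\<omega> j) (\<omega> k)) \<in> borel_measurable ?S"
      using measurable_compose[OF measurable_Pair g[OF \<open>k \<in> K\<close>], of "\<lambda>\<omega>. \<omega> j" ?S "\<lambda>\<omega>. \<omega> k"] \<open>k \<in> K\<close>
      by (auto intro: measurable_component_singleton)
  qed
  have "(\<integral>\<^sup>+\<omega>. ?F \<omega> \<partial>(\<Pi>\<^sub>M i\<in>UNIV. N)) = (\<integral>\<^sup>+\<omega>. ?F (restrict \<omega> (insert j K)) \<partial>(\<Pi>\<^sub>M i\<in>UNIV. N))"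
    by (intro nn_integral_cong) (auto intro!: prod.cong)
  also have "\<dots> = (\<integral>\<^sup>+\<omega>. ?F \<omega> \<partial>(distr (\<Pi>\<^sub>M i\<in>UNIV. N) ?S (\<lambda>\<omega>. restrict \<omega> (insert j K))))"
    using F by (subst nn_integral_distr) (auto intro!: measurable_restrict_subset)
  also have "\<dots> = (\<integral>\<^sup>+\<omega>. ?F \<omega> \<partial>?S)"
    using K by (subst pps.distr_PiM_restrict_finite) auto
  also have "\<dots> = (\<integral>\<^sup>+z. \<integral>\<^sup>+\<omega>. ?F (fun_upd \<omega> j z) \<partial>(\<Pi>\<^sub>M i\<in>K. N) \<partial>N)"
    using K F by (intro pps.product_nn_integral_insert_rev) auto
  also have "\<dots> = (\<integral>\<^sup>+z. h z * (\<Prod>k\<in>K. \<integral>\<^sup>+w. g k z w \<partial>N) \<partial>N)"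
  proof (rule nn_integral_cong)
    fix z assume z: "z \<in> space N"
    have gz: "g k z \<in> borel_measurable N" if "k \<in> K" for k
      using z that by (intro g') auto
    have "(\<integral>\<^sup>+\<omega>. ?F (fun_upd \<omega> j z) \<partial>(\<Pi>\<^sub>M i\<in>K. N)) = (\<integral>\<^sup>+\<omega>. h z * (\<Prod>k\<in>K. g k z (\<omega> k)) \<partial>(\<Pi>\<^sub>M i\<in>K. N))"
      using K by (intro nn_integral_cong arg_cong2[where f="(*)"] prod.cong) auto
    also have "\<dots> = h z * (\<integral>\<^sup>+\<omega>. (\<Prod>k\<in>K. g k z (\<omega> k)) \<partial>(\<Pi>\<^sub>M i\<in>K. N))"
    proof (intro nn_integral_cmult borel_measurable_prod_ennreal)
      fix k assume "k \<in> K"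
      then show "(\<lambda>\<omega>. g k z (\<omega> k)) \<in> borel_measurable (\<Pi>\<^sub>M i\<in>K. N)"
        using measurable_compose[OF measurable_component_singleton[of k K "\<lambda>_. N"] gz] by simp
    qed
    also have "\<dots> = h z * (\<Prod>k\<in>K. \<integral>\<^sup>+w. g k z w \<partial>N)"
      using K gz by (subst pps.product_nn_integral_prod) auto
    finally show "(\<integral>\<^sup>+\<omega>. ?F (fun_upd \<omega> j z) \<partial>(\<Pi>\<^sub>M i\<in>K. N)) = h z * (\<Prod>k\<in>K. \<integral>\<^sup>+w. g k z w \<partial>N)" .
  qed
  finally show ?thesis .
qed

abbreviation unif01 :: "real measure" where
  "unif01 \<equiv> uniform_measure lborel {0..1}"

lemma prob_space_unif01: "prob_space unif01"
  by (rule prob_space_uniform_measure) auto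

lemma measurable_unif01: "measurable unif01 L = measurable borel L"
  by (rule measurable_cong_sets) auto

lemma nn_integral_unif01:
  "f \<in> borel_measurable borel \<Longrightarrow> (\<integral>\<^sup>+x. f x \<partial>unif01) = (\<integral>\<^sup>+x. f x * indicator {0..1} x \<partial>lborel)"
  by (subst nn_integral_uniform_measure) (auto simp: divide_ennreal_def)

lemma emeasure_unif01_Ioc:
  "0 \<le> a \<Longrightarrow> b \<le> 1 \<Longrightarrow> emeasure unif01 {a<..b} = ennreal (max 0 (b - a))"
proof -
  assume "0 \<le> a" "b \<le> 1"
  then have "{0..1} \<inter> {a<..b} = {a<..b}" by auto
  then show ?thesis by (cases "a \<le> b") (auto simp: max_def divide_ennreal_def)
qed

lemma emeasure_unif01_greater:
  "0 \<le> a \<Longrightarrow> a \<le> 1 \<Longrightarrow> emeasure unif01 {a<..} = ennreal (1 - a)"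
proof -
  assume "0 \<le> a" "a \<le> 1"
  then have "{0..1} \<inter> {a<..} = {a<..1}" by auto
  then show ?thesis using \<open>a \<le> 1\<close> by (simp add: divide_ennreal_def)
qed

lemma emeasure_unif01_atMost:
  "0 \<le> b \<Longrightarrow> b \<le> 1 \<Longrightarrow> emeasure unif01 {..b} = ennreal b"
proof -
  assume "0 \<le> b" "b \<le> 1"
  then have "{0..1} \<inter> {..b} = {0..b}" by auto
  then show ?thesis using \<open>0 \<le> b\<close> by (simp add: divide_ennreal_def)
qed

lemma AE_unif01: "AE s in unif01. s \<in> {0..1}"
  by (rule AE_uniform_measureI) auto

lemma ennreal_le_suminf: "(f :: nat \<Rightarrow> ennreal) i \<le> suminf f"
  using sum_le_suminf[of f "{i}"] by simp

section \<open>Measurability of sorting by random keys\<close>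

lemma measurable_insort_key:
  assumes T: "\<And>i. (\<lambda>t. t i) \<in> borel_measurable T"
  shows "(\<lambda>t. insort_key (t :: nat \<Rightarrow> real) x l) \<in> measurable T (count_space UNIV)"
proof (induction l)
  case Nil
  then show ?case by simp
next
  case (Cons y l)
  note [measurable] = T
  have [measurable]: "(\<lambda>t. y # insort_key t x l) \<in> measurable T (count_space UNIV)"
    by (rule measurable_compose[OF Cons]) simp
  show ?case unfolding insort_key.simps by measurable
qed

text \<open>The keys enter only through comparisons, and the sorted tail takes countably many
  values, so insertion into it may be treated one value at a time.\<close>

lemma measurable_sort_key:
  assumes T: "\<And>i. (\<lambda>t. t i) \<in> borel_measurable T"
  shows "(\<lambda>t. sort_key (t :: nat \<Rightarrow> real) l) \<in> measurable T (count_space UNIV)"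
proof (induction l)
  case Nil
  then show ?case by (simp add: sort_key_def)
next
  case (Cons x l)
  have "(\<lambda>t. insort_key t x (sort_key t l)) \<in> measurable T (count_space UNIV)"
    by (rule measurable_compose_countable[OF measurable_insort_key[OF T] Cons])
  then show ?case by (simp add: sort_key_def)
qed

lemma prod_if_1_0: "finite K \<Longrightarrow> (\<Prod>k\<in>K. if b k then 1 else 0) = (if \<forall>k\<in>K. b k then 1 else 0 :: ennreal)"
  by (induction rule: finite_induct) auto

section \<open>Truncated Beta integrals\<close>

lemma DERIV_one_minus_divide_power:
  fixes r s :: real
  shows "((\<lambda>s. (1 - s / r) ^ Suc k) has_real_derivative real (Suc k) * (1 - s / r) ^ k * (- (1 / r))) (at s)"
  by (rule DERIV_cong[OF DERIV_power[OF DERIV_diff[OF DERIV_const DERIV_cdivide[OF DERIV_ident]]]]) simp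

text \<open>With score u = s / r, the integrand is the chance that m independent rivals all score
  worse; the substitution s = r u produces the factor r.\<close>

lemma nn_integral_power_Icc:
  fixes r b :: real
  assumes "r > 0" "0 \<le> b" "b \<le> r" "b \<le> 1"
  shows "(\<integral>\<^sup>+s. ennreal ((1 - s / r) ^ m) * indicator {..b} s \<partial>unif01) =
    ennreal (r * (1 - (1 - b / r) ^ Suc m) / Suc m)"
proof -
  let ?F = "\<lambda>s. - (r * (1 - s / r) ^ Suc m / Suc m)"
  have "(\<integral>\<^sup>+s. ennreal ((1 - s / r) ^ m) * indicator {..b} s \<partial>unif01) =
    (\<integral>\<^sup>+s. ennreal ((1 - s / r) ^ m) * indicator {0..b} s \<partial>lborel)"
    using assms
    by (subst nn_integral_unif01) (auto intro!: nn_integral_cong simp: indicator_def)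
  also have "\<dots> = ennreal (?F b - ?F 0)"
  proof (rule nn_integral_FTC_Icc)
    fix s assume s: "s \<in> {0..b}"
    then show "0 \<le> (1 - s / r) ^ m" using assms by (auto simp: divide_le_eq)
    show "(?F has_real_derivative (1 - s / r) ^ m) (at s)"
      by (rule DERIV_cong[OF DERIV_minus[OF DERIV_cdivide[OF DERIV_cmult[OF DERIV_one_minus_divide_power]]]])
         (use assms in \<open>simp add: field_simps del: of_nat_Suc\<close>)
  qed (use assms in auto)
  also have "?F b - ?F 0 = r * (1 - (1 - b / r) ^ Suc m) / Suc m"
    by (simp add: right_diff_distrib diff_divide_distrib del: power_Suc of_nat_Suc)
  finally show ?thesis .
qed

text \<open>The complete integral is r B(2, m + 1). The antiderivative comes from integration by
  parts; it is nonpositive at b, so truncation costs only an inequality.\<close>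

lemma nn_integral_times_power_le:
  fixes r b :: real
  assumes "r > 0" "0 \<le> b" "b \<le> r" "b \<le> 1"
  shows "(\<integral>\<^sup>+s. ennreal (s / r * (1 - s / r) ^ m) * indicator {..b} s \<partial>unif01) \<le>
    ennreal (r / (real (Suc m) * real (Suc (Suc m))))"
proof -
  let ?F = "\<lambda>s. - (r * ((s / r) * (1 - s / r) ^ Suc m / Suc m + (1 - s / r) ^ Suc (Suc m) / (real (Suc m) * real (Suc (Suc m)))))"
  have "(\<integral>\<^sup>+s. ennreal (s / r * (1 - s / r) ^ m) * indicator {..b} s \<partial>unif01) =
    (\<integral>\<^sup>+s. ennreal (s / r * (1 - s / r) ^ m) * indicator {0..b} s \<partial>lborel)"
    using assms
    by (subst nn_integral_unif01) (auto intro!: nn_integral_cong simp: indicator_def)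
  also have "\<dots> = ennreal (?F b - ?F 0)"
  proof (rule nn_integral_FTC_Icc)
    fix s assume s: "s \<in> {0..b}"
    then show "0 \<le> s / r * (1 - s / r) ^ m" using assms by (auto simp: divide_le_eq)
    show "(?F has_real_derivative s / r * (1 - s / r) ^ m) (at s)"
    proof (rule DERIV_cong[OF DERIV_minus[OF DERIV_cmult[OF DERIV_add[OF DERIV_cdivide[OF DERIV_mult[OF
            DERIV_cdivide[OF DERIV_ident] DERIV_one_minus_divide_power]] DERIV_cdivide[OF DERIV_one_minus_divide_power]]]]])
      define v where "v = 1 - s / r"
      define a where "a = real (Suc m)"
      define c where "c = real (Suc (Suc m))"
      have "a > 0" "c > 0" by (auto simp: a_def c_def)
      then show "- (r * ((1 / r * (1 - s / r) ^ Suc m + real (Suc m) * (1 - s / r) ^ m * - (1 / r) * (s / r)) / real (Suc m) +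
           real (Suc (Suc m)) * (1 - s / r) ^ Suc m * - (1 / r) / (real (Suc m) * real (Suc (Suc m))))) = s / r * (1 - s / r) ^ m"
        using assms unfolding v_def[symmetric] a_def[symmetric] c_def[symmetric]
        by (simp add: field_simps)
    qed
  qed (use assms in auto)
  also have "\<dots> \<le> ennreal (r / (real (Suc m) * real (Suc (Suc m))))"
  proof (rule ennreal_leI)
    have "0 \<le> 1 - b / r" using assms by (auto simp: divide_le_eq)
    then have "?F b \<le> 0" using assms
      by (simp del: of_nat_Suc power_Suc)
    then show "?F b - ?F 0 \<le> r / (real (Suc m) * real (Suc (Suc m)))"
      by simp
  qed
  finally show ?thesis .
qed

section \<open>The race\<close>

text \<open>\<open>R\<close> bounds the likelihood ratio, so for scores u \<le> 1 / R every
  threshold u * r z stays within the range [0, 1] of arrival times. The first \<open>n\<close>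
  samples race.\<close>

locale race =
  fixes A :: "'a set" and P Q :: "'a pmf" and R :: real and n :: nat
  assumes finA: "finite A" and supp: "set_pmf P \<subseteq> A" "set_pmf Q \<subseteq> A"
    and R1: "R \<ge> 1" and Q_le: "\<And>x. x \<in> A \<Longrightarrow> pmf Q x \<le> R * pmf P x"
    and n2: "n \<ge> 2"
begin

definition r :: "'a \<Rightarrow> real" where "r x = pmf Q x / pmf P x"

lemma r_nonneg: "r x \<ge> 0" by (simp add: r_def)

text \<open>Where P x = 0, division by zero makes \<open>r x\<close> = 0, and \<open>Q_le\<close>
  forces Q x = 0.\<close>

lemma Q_eq: "x \<in> A \<Longrightarrow> pmf P x * r x = pmf Q x"
  using Q_le[of x] by (auto simp: r_def)

lemma r_le: "x \<in> A \<Longrightarrow> r x \<le> R"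
  using Q_le[of x] R1 by (cases "pmf P x = 0") (auto simp: r_def divide_le_eq less_le)

lemma r_div_R: "x \<in> A \<Longrightarrow> r x / R \<le> 1" using r_le R1 by (auto simp: divide_le_eq)

lemma sum_P: "(\<Sum>x\<in>A. pmf P x) = 1" and sum_Q: "(\<Sum>x\<in>A. pmf Q x) = 1"
  using finA supp by (auto intro!: sum_pmf_eq_1)

text \<open>\<open>P\<close> as a measure whose space is \<open>A\<close> rather than
  \<open>UNIV\<close>, because \<open>simulator\<close> asks for variables with values in
  \<open>count_space A\<close>.\<close>

definition NP :: "'a measure" where "NP = point_measure A (\<lambda>x. ennreal (pmf P x))"

lemma space_NP [simp]: "space NP = A" by (simp add: NP_def space_point_measure)

lemma sets_NP [measurable_cong]: "sets NP = sets (count_space A)"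
  by (simp add: NP_def sets_point_measure_count_space)

lemma prob_space_NP: "prob_space NP"
  unfolding NP_def using finA sum_P by (intro prob_space_point_measure) auto

lemma nn_integral_NP: "(\<integral>\<^sup>+x. f x \<partial>NP) = (\<Sum>x\<in>A. ennreal (pmf P x) * f x)"
  unfolding NP_def using finA by (subst nn_integral_point_measure_finite) auto

text \<open>In a point of \<open>W\<close>, sample j has value \<open>fst \<omega> j\<close> and
  time \<open>snd \<omega> j\<close>. For j \<ge> n the time does not affect the order and serves
  only as an acceptance coin.\<close>

definition SY :: "(nat \<Rightarrow> 'a) measure" where "SY = (\<Pi>\<^sub>M i\<in>UNIV. NP)"
definition ST :: "(nat \<Rightarrow> real) measure" where "ST = (\<Pi>\<^sub>M i\<in>UNIV. unif01)"
definition W :: "((nat \<Rightarrow> 'a) \<times> (nat \<Rightarrow> real)) measure" where "W = SY \<Otimes>\<^sub>M ST"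

sublocale SY: prob_space SY unfolding SY_def by (intro prob_space_PiM prob_space_NP)
sublocale ST: prob_space ST unfolding ST_def by (intro prob_space_PiM prob_space_unif01)
sublocale SYT: pair_prob_space SY ST ..
sublocale W: prob_space W unfolding W_def by (rule SYT.prob_space_axioms)

lemma Y_measurable [measurable]: "(\<lambda>\<omega>. fst \<omega> i) \<in> measurable W (count_space A)"
proof -
  have "(\<lambda>Y. Y i) \<in> measurable SY (count_space A)"
    unfolding SY_def using measurable_component_singleton[of i UNIV "\<lambda>_. NP"]
    by (simp add: measurable_cong_sets[OF refl sets_NP])
  then show ?thesis unfolding W_def by (rule measurable_compose[OF measurable_fst])
qed

lemma ST_measurable [measurable]: "(\<lambda>t. t i) \<in> borel_measurable ST"
  unfolding ST_def using measurable_component_singleton[of i UNIV "\<lambda>_. unif01"]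
  by (simp cong: measurable_cong_sets)

lemma t_measurable [measurable]: "(\<lambda>\<omega>. snd \<omega> i) \<in> borel_measurable W"
  unfolding W_def by (rule measurable_compose[OF measurable_snd ST_measurable])

lemma Y_space: "\<omega> \<in> space W \<Longrightarrow> fst \<omega> i \<in> A"
  using measurable_space[OF Y_measurable] by simp

lemma r_Y_measurable [measurable]: "(\<lambda>\<omega>. r (fst \<omega> i)) \<in> borel_measurable W"
  by (rule measurable_compose[OF Y_measurable]) simp

lemma Y_eq_measurable [measurable]: "Measurable.pred W (\<lambda>\<omega>. fst \<omega> i = y)"
  by (rule measurable_compose[OF Y_measurable]) simp

text \<open>The pairwise product lemma is applied twice: to the samples for fixed times, where
  fixing sample j to y leaves the weight P y, and then to the times.\<close>

lemma nn_integral_W_prod: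
  assumes K: "finite K" "j \<notin> K" and y: "y \<in> A"
    and h: "h \<in> borel_measurable borel"
    and g: "\<And>k z. k \<in> K \<Longrightarrow> z \<in> A \<Longrightarrow> (\<lambda>(s, w). g k s z w) \<in> borel_measurable (borel \<Otimes>\<^sub>M borel)"
  shows "(\<integral>\<^sup>+\<omega>. indicator {y} (fst \<omega> j) * h (snd \<omega> j) * (\<Prod>k\<in>K. g k (snd \<omega> j) (fst \<omega> k) (snd \<omega> k)) \<partial>W) =
    ennreal (pmf P y) * (\<integral>\<^sup>+s. h s * (\<Prod>k\<in>K. \<Sum>z\<in>A. ennreal (pmf P z) * (\<integral>\<^sup>+w. g k s z w \<partial>unif01)) \<partial>unif01)"
proof -
  let ?F = "\<lambda>\<omega>. indicator {y} (fst \<omega> j) * h (snd \<omega> j) * (\<Prod>k\<in>K. g k (snd \<omega> j) (fst \<omega> k) (snd \<omega> k))"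
  let ?G = "\<lambda>k s w. \<Sum>z\<in>A. ennreal (pmf P z) * g k s z w"
  note [measurable] = h
  have gW: "(\<lambda>\<omega>. g k (snd \<omega> j) (fst \<omega> k) (snd \<omega> k)) \<in> borel_measurable W" if k: "k \<in> K" for k
  proof (rule measurable_compose_countable'[where I=A and g="\<lambda>\<omega>. fst \<omega> k"])
    fix z assume z: "z \<in> A"
    show "(\<lambda>\<omega>. g k (snd \<omega> j) z (snd \<omega> k)) \<in> borel_measurable W"
      using measurable_compose[OF measurable_Pair[OF t_measurable t_measurable] g[OF k z]] by simp
  qed (use finA in \<open>auto intro: countable_finite\<close>)
  have F: "?F \<in> borel_measurable (SY \<Otimes>\<^sub>M ST)"
    unfolding W_def[symmetric]
    by (intro borel_measurable_times_ennreal borel_measurable_prod_ennreal gW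
          measurable_compose[OF Y_measurable] measurable_compose[OF t_measurable h]) auto
  have "(\<integral>\<^sup>+\<omega>. ?F \<omega> \<partial>W) = (\<integral>\<^sup>+t. \<integral>\<^sup>+Y. ?F (Y, t) \<partial>SY \<partial>ST)"
    unfolding W_def using SYT.nn_integral_snd[OF F] by simp
  also have "\<dots> = (\<integral>\<^sup>+t. ennreal (pmf P y) * (h (t j) * (\<Prod>k\<in>K. ?G k (t j) (t k))) \<partial>ST)"
  proof (rule nn_integral_cong)
    fix t
    have "(\<integral>\<^sup>+Y. ?F (Y, t) \<partial>SY) =
      (\<integral>\<^sup>+Y. (indicator {y} (Y j) * h (t j)) * (\<Prod>k\<in>K. g k (t j) (Y k) (t k)) \<partial>SY)" by simp
    also have "\<dots> = (\<integral>\<^sup>+z. (indicator {y} z * h (t j)) * (\<Prod>k\<in>K. \<integral>\<^sup>+w. g k (t j) w (t k) \<partial>NP) \<partial>NP)"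
      unfolding SY_def
    proof (rule nn_integral_PiM_pairwise_prod[OF prob_space_NP K, of "\<lambda>z. indicator {y} z * h (t j)" "\<lambda>k z w. g k (t j) w (t k)"])
      show "(\<lambda>z. indicator {y} z * h (t j)) \<in> borel_measurable NP"
        by (simp add: measurable_cong_sets[OF sets_NP refl])
      show "(\<lambda>(z, w). g k (t j) w (t k)) \<in> borel_measurable (NP \<Otimes>\<^sub>M NP)" for k
      proof -
        have "(\<lambda>w. g k (t j) w (t k)) \<in> borel_measurable NP"
          by (simp add: measurable_cong_sets[OF sets_NP refl])
        then show ?thesis unfolding case_prod_beta' by (rule measurable_compose[OF measurable_snd])
      qed
    qed
    also have "\<dots> = (\<Sum>z\<in>A. if z = y then ennreal (pmf P y) * (h (t j) * (\<Prod>k\<in>K. ?G k (t j) (t k))) else 0)"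
      unfolding nn_integral_NP by (intro sum.cong) (auto simp: mult_ac)
    also have "\<dots> = ennreal (pmf P y) * (h (t j) * (\<Prod>k\<in>K. ?G k (t j) (t k)))"
      using finA y by (simp add: sum.delta)
    finally show "(\<integral>\<^sup>+Y. ?F (Y, t) \<partial>SY) = \<dots>" .
  qed
  also have "\<dots> = ennreal (pmf P y) * (\<integral>\<^sup>+t. h (t j) * (\<Prod>k\<in>K. ?G k (t j) (t k)) \<partial>ST)"
  proof (intro nn_integral_cmult borel_measurable_times_ennreal borel_measurable_prod_ennreal borel_measurable_sum)
    fix k z assume kz: "k \<in> K" "z \<in> A"
    show "(\<lambda>t. ennreal (pmf P z)) \<in> borel_measurable ST" by simp
    show "(\<lambda>t. g k (t j) z (t k)) \<in> borel_measurable ST"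
      using measurable_compose[OF measurable_Pair[OF ST_measurable ST_measurable] g[OF kz]] by simp
  qed measurable
  also have "(\<integral>\<^sup>+t. h (t j) * (\<Prod>k\<in>K. ?G k (t j) (t k)) \<partial>ST) =
      (\<integral>\<^sup>+s. h s * (\<Prod>k\<in>K. \<integral>\<^sup>+w. ?G k s w \<partial>unif01) \<partial>unif01)"
    unfolding ST_def
  proof (rule nn_integral_PiM_pairwise_prod[OF prob_space_unif01 K])
    show "h \<in> borel_measurable unif01" using h by (simp add: measurable_unif01)
    have *: "sets (unif01 \<Otimes>\<^sub>M unif01) = sets (borel \<Otimes>\<^sub>M borel)" by (intro sets_pair_measure_cong) auto
    have "(\<lambda>x. \<Sum>z\<in>A. ennreal (pmf P z) * (case x of (s, w) \<Rightarrow> g k s z w)) \<in> borel_measurable (borel \<Otimes>\<^sub>M borel)"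
      if "k \<in> K" for k
      using g that by (intro borel_measurable_sum borel_measurable_times_ennreal) auto
    then show "(\<lambda>(s, w). ?G k s w) \<in> borel_measurable (unif01 \<Otimes>\<^sub>M unif01)" if "k \<in> K" for k
      unfolding measurable_cong_sets[OF * refl] using that by (simp only: case_prod_beta')
  qed
  also have "\<dots> = (\<integral>\<^sup>+s. h s * (\<Prod>k\<in>K. \<Sum>z\<in>A. ennreal (pmf P z) * (\<integral>\<^sup>+w. g k s z w \<partial>unif01)) \<partial>unif01)"
  proof (intro nn_integral_cong arg_cong2[where f="(*)"] prod.cong refl)
    fix s k assume k: "k \<in> K"
    have gs: "(\<lambda>w. g k s z w) \<in> borel_measurable unif01" if "z \<in> A" for z
      unfolding measurable_unif01
      using measurable_compose[OF measurable_Pair[OF measurable_const measurable_ident] g[OF k that]]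
      by simp
    show "(\<integral>\<^sup>+w. ?G k s w \<partial>unif01) = (\<Sum>z\<in>A. ennreal (pmf P z) * (\<integral>\<^sup>+w. g k s z w \<partial>unif01))"
      by (subst nn_integral_sum, intro borel_measurable_times_ennreal gs)
         (auto intro!: sum.cong nn_integral_cmult gs)
  qed
  finally show ?thesis .
qed

section \<open>The selection rule\<close>

text \<open>The acceptance test of rejection sampling, passed by y with probability
  \<open>r y / R\<close> for uniform t; equivalently, the score is at most 1 / R. The first conjunct
  rejects values of ratio 0 even at t = 0.\<close>

definition acc :: "'a \<Rightarrow> real \<Rightarrow> bool" where "acc y t \<longleftrightarrow> r y > 0 \<and> t \<le> r y / R"

text \<open>
  For \<open>j < n\<close>, sample \<open>j\<close> has an admissible score that is strictly least among the first \<open>n\<close>; scores are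
  compared in multiplied-out form because \<open>r\<close> may vanish. For \<open>j \<ge> n\<close>, sample \<open>j\<close> is the first admissible one at all.
\<close>

definition sel :: "nat \<Rightarrow> (nat \<Rightarrow> 'a) \<times> (nat \<Rightarrow> real) \<Rightarrow> bool" where
  "sel j \<omega> \<longleftrightarrow> acc (fst \<omega> j) (snd \<omega> j) \<and>
     (if j < n then (\<forall>k\<in>{..<n} - {j}. snd \<omega> j / r (fst \<omega> j) * r (fst \<omega> k) < snd \<omega> k)
      else (\<forall>k\<in>{..<j}. \<not> acc (fst \<omega> k) (snd \<omega> k)))"

text \<open>Two selected samples of the block would each have the strictly smaller score; a selected
  sample beyond the block requires that no earlier sample is admissible.\<close>

lemma sel_unique: "sel j \<omega> \<Longrightarrow> sel k \<omega> \<Longrightarrow> j = k"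
proof (induction j k rule: linorder_wlog)
  case (le j k)
  show ?case
  proof (rule ccontr)
    assume "j \<noteq> k"
    with le(1) have jk: "j < k" by simp
    show False
    proof (cases "k < n")
      case True
      have r: "r (fst \<omega> j) > 0" "r (fst \<omega> k) > 0" using le by (auto simp: sel_def acc_def)
      have "snd \<omega> j / r (fst \<omega> j) * r (fst \<omega> k) < snd \<omega> k" "snd \<omega> k / r (fst \<omega> k) * r (fst \<omega> j) < snd \<omega> j"
        using le jk True by (auto simp: sel_def)
      then show False using r by (simp add: field_simps)
    next
      case False
      then show False using le jk by (auto simp: sel_def)
    qed
  qed
qed auto

lemma acc_measurable [measurable]: "Measurable.pred W (\<lambda>\<omega>. acc (fst \<omega> k) (snd \<omega> k))"
  unfolding acc_def by measurable

lemma sel_measurable [measurable]: "Measurable.pred W (sel j)"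
  unfolding sel_def by measurable

section \<open>Probabilities of the selection events\<close>

definition E :: "nat \<Rightarrow> 'a \<Rightarrow> ((nat \<Rightarrow> 'a) \<times> (nat \<Rightarrow> real)) set" where
  "E j y = {\<omega>\<in>space W. sel j \<omega> \<and> fst \<omega> j = y}"

lemma E_event [measurable]: "E j y \<in> sets W"
  unfolding E_def by measurable

lemma E_empty: "r y = 0 \<Longrightarrow> E j y = {}" by (auto simp: E_def sel_def acc_def)

text \<open>Given the arrival time s of sample j, every other sample k satisfies its condition
  \<open>G k\<close> independently.\<close>

lemma emeasure_W_event:
  assumes K: "finite K" "j \<notin> K" and y: "y \<in> A"
    and H [measurable]: "Measurable.pred borel H"
    and G: "\<And>k z. k \<in> K \<Longrightarrow> z \<in> A \<Longrightarrow> Measurable.pred (borel \<Otimes>\<^sub>M borel) (\<lambda>(s, w). G k s z w)"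
    and B: "B = {\<omega>\<in>space W. fst \<omega> j = y \<and> H (snd \<omega> j) \<and> (\<forall>k\<in>K. G k (snd \<omega> j) (fst \<omega> k) (snd \<omega> k))}"
      "B \<in> sets W"
  shows "emeasure W B = ennreal (pmf P y) *
     (\<integral>\<^sup>+s. (if H s then 1 else 0) * (\<Prod>k\<in>K. \<Sum>z\<in>A. ennreal (pmf P z) * emeasure unif01 {w. G k s z w}) \<partial>unif01)"
proof -
  have Gs: "{w. G k s z w} \<in> sets borel" if "k \<in> K" "z \<in> A" for k s z
  proof -
    have "Pair s \<in> measurable borel (borel \<Otimes>\<^sub>M borel)" by measurable
    from measurable_compose[OF this G[OF that]] show ?thesis by (simp add: pred_def)
  qed
  have "emeasure W B = (\<integral>\<^sup>+\<omega>. indicator B \<omega> \<partial>W)" using B(2) by simp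
  also have "\<dots> = (\<integral>\<^sup>+\<omega>. indicator {y} (fst \<omega> j) * (if H (snd \<omega> j) then 1 else 0) *
      (\<Prod>k\<in>K. if G k (snd \<omega> j) (fst \<omega> k) (snd \<omega> k) then 1 else 0) \<partial>W)"
    using K by (intro nn_integral_cong) (auto simp: B(1) prod_if_1_0 indicator_def)
  also have "\<dots> = ennreal (pmf P y) * (\<integral>\<^sup>+s. (if H s then 1 else 0) *
     (\<Prod>k\<in>K. \<Sum>z\<in>A. ennreal (pmf P z) * (\<integral>\<^sup>+w. (if G k s z w then 1 else 0) \<partial>unif01)) \<partial>unif01)"
  proof (rule nn_integral_W_prod[OF K y])
    fix k z assume kz: "k \<in> K" "z \<in> A"
    show "(\<lambda>(s, w). if G k s z w then 1 else 0 :: ennreal) \<in> borel_measurable (borel \<Otimes>\<^sub>M borel)"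
    proof -
      have "Measurable.pred (borel \<Otimes>\<^sub>M borel) (\<lambda>x. G k (fst x) z (snd x))"
        using G[OF kz] by (simp add: case_prod_beta')
      then show ?thesis by (simp add: case_prod_beta')
    qed
  qed measurable
  also have "\<dots> = ennreal (pmf P y) *
     (\<integral>\<^sup>+s. (if H s then 1 else 0) * (\<Prod>k\<in>K. \<Sum>z\<in>A. ennreal (pmf P z) * emeasure unif01 {w. G k s z w}) \<partial>unif01)"
  proof (intro arg_cong2[where f="(*)"] nn_integral_cong prod.cong sum.cong refl)
    fix k z s assume kz: "k \<in> K" "z \<in> A"
    have "(\<integral>\<^sup>+w. (if G k s z w then 1 else 0) \<partial>unif01) = (\<integral>\<^sup>+w. indicator {w. G k s z w} w \<partial>unif01)"
      by (intro nn_integral_cong) (auto simp: indicator_def)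
    also have "\<dots> = emeasure unif01 {w. G k s z w}" using Gs[OF kz] by (intro nn_integral_indicator) simp
    finally show "(\<integral>\<^sup>+w. (if G k s z w then 1 else 0) \<partial>unif01) = emeasure unif01 {w. G k s z w}" .
  qed
  finally show ?thesis .
qed

text \<open>The event says that a random sample scores worse than u. As no threshold exceeds 1, its
  probability is linear in u, with slope -\<Sum> P z r z = -\<Sum> Q z = -1. Up to 1 / R a score is
  thus distributed like a uniform variable, whatever P and Q are.\<close>

lemma prob_later_score:
  assumes "0 \<le> u" "u \<le> 1 / R"
  shows "(\<Sum>z\<in>A. ennreal (pmf P z) * emeasure unif01 {w. u * r z < w}) = ennreal (1 - u)"
proof -
  have ur: "0 \<le> u * r z" "u * r z \<le> 1" if "z \<in> A" for z
  proof -
    show "0 \<le> u * r z" using assms r_nonneg by simp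
    have "u * r z \<le> 1 / R * R" using assms r_nonneg r_le[OF that] R1 by (intro mult_mono) auto
    then show "u * r z \<le> 1" using R1 by simp
  qed
  have "(\<Sum>z\<in>A. ennreal (pmf P z) * emeasure unif01 {w. u * r z < w}) = (\<Sum>z\<in>A. ennreal (pmf P z * (1 - u * r z)))"
    using ur emeasure_unif01_greater
    by (intro sum.cong) (auto simp: ennreal_mult' greaterThan_def[symmetric])
  also have "\<dots> = ennreal (\<Sum>z\<in>A. pmf P z * (1 - u * r z))"
    using ur by (intro sum_ennreal) auto
  also have "(\<Sum>z\<in>A. pmf P z * (1 - u * r z)) = (\<Sum>z\<in>A. pmf P z - u * pmf Q z)"
    by (intro sum.cong refl) (simp add: Q_eq[symmetric] algebra_simps)
  also have "\<dots> = 1 - u" by (simp add: sum_subtractf sum_distrib_left[symmetric] sum_P sum_Q)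
  finally show ?thesis .
qed

text \<open>u * r y is the arrival time of a sample of value y and score u. The event is a rival
  that arrives no later but scores worse, an interval of length u (r y - r z)^+ for each rival value
  z.\<close>

lemma prob_overtaking:
  assumes "0 \<le> u" "u * r y \<le> 1"
  shows "(\<Sum>z\<in>A. ennreal (pmf P z) * emeasure unif01 {w. u * r z < w \<and> w \<le> u * r y}) = ennreal (u * overtaken A P Q y)"
proof -
  have "(\<Sum>z\<in>A. ennreal (pmf P z) * emeasure unif01 {w. u * r z < w \<and> w \<le> u * r y}) =
     (\<Sum>z\<in>A. ennreal (pmf P z * max 0 (u * r y - u * r z)))"
  proof (intro sum.cong refl)
    fix z
    have "{w. u * r z < w \<and> w \<le> u * r y} = {u * r z<..u * r y}" by auto
    then show "ennreal (pmf P z) * emeasure unif01 {w. u * r z < w \<and> w \<le> u * r y} =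
      ennreal (pmf P z * max 0 (u * r y - u * r z))"
      using emeasure_unif01_Ioc[of "u * r z" "u * r y"] assms r_nonneg by (simp add: ennreal_mult')
  qed
  also have "\<dots> = ennreal (\<Sum>z\<in>A. pmf P z * max 0 (u * r y - u * r z))"
    by (intro sum_ennreal) auto
  also have "(\<Sum>z\<in>A. pmf P z * max 0 (u * r y - u * r z)) = u * overtaken A P Q y"
    unfolding overtaken_def sum_distrib_left
  proof (intro sum.cong refl)
    fix z assume "z \<in> A"
    have "pmf P z * max 0 (u * r y - u * r z) = max 0 ((pmf P z * u) * (r y - r z))"
      by (subst max_mult_distrib_left) (auto simp: algebra_simps)
    also have "\<dots> = u * max 0 (pmf P z * r y - pmf P z * r z)"
      using assms(1) by (simp add: max_mult_distrib_left right_diff_distrib mult_ac)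
    also have "\<dots> = u * max 0 (pmf P z * (pmf Q y / pmf P y) - pmf Q z)"
      using Q_eq[OF \<open>z \<in> A\<close>] by (simp add: r_def)
    finally show "pmf P z * max 0 (u * r y - u * r z) = u * max 0 (pmf P z * (pmf Q y / pmf P y) - pmf Q z)" .
  qed
  finally show ?thesis .
qed

text \<open>Given its own score u, sample j beats the n - 1 others with probability (1 - u)^(n - 1).
  Integrating over times up to r y / R yields the factor r y that turns P y into Q y. The remaining
  factors are the chance that some score of the block is admissible and 1/n by symmetry.\<close>

lemma emeasure_E_block:
  assumes j: "j < n" and y: "y \<in> A"
  shows "emeasure W (E j y) = ennreal (pmf Q y * (1 - (1 - 1 / R) ^ n) / n)"
proof (cases "r y = 0")
  case True
  then show ?thesis using E_empty Q_eq[OF y] by simp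
next
  case False
  then have ry: "r y > 0" using r_nonneg[of y] by simp
  let ?K = "{..<n} - {j}"
  have "emeasure W (E j y) = ennreal (pmf P y) * (\<integral>\<^sup>+s. (if s \<le> r y / R then 1 else 0) *
     (\<Prod>k\<in>?K. \<Sum>z\<in>A. ennreal (pmf P z) * emeasure unif01 {w. s / r y * r z < w}) \<partial>unif01)"
    using j ry
    by (intro emeasure_W_event[where j=j] y E_event) (auto simp: E_def sel_def acc_def)
  also have "(\<integral>\<^sup>+s. (if s \<le> r y / R then 1 else 0) *
     (\<Prod>k\<in>?K. \<Sum>z\<in>A. ennreal (pmf P z) * emeasure unif01 {w. s / r y * r z < w}) \<partial>unif01)
     = (\<integral>\<^sup>+s. ennreal ((1 - s / r y) ^ (n - 1)) * indicator {..r y / R} s \<partial>unif01)"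
  proof (rule nn_integral_cong_AE, rule AE_mp[OF AE_unif01], rule AE_I2, rule impI)
    fix s :: real assume s: "s \<in> {0..1}"
    show "(if s \<le> r y / R then 1 else 0) *
     (\<Prod>k\<in>?K. \<Sum>z\<in>A. ennreal (pmf P z) * emeasure unif01 {w. s / r y * r z < w}) =
      ennreal ((1 - s / r y) ^ (n - 1)) * indicator {..r y / R} s"
    proof (cases "s \<le> r y / R")
      case True
      then have u: "0 \<le> s / r y" "s / r y \<le> 1 / R" using s ry R1 by (auto simp: field_simps)
      moreover have "1 / R \<le> 1" using R1 by simp
      ultimately have "0 \<le> 1 - s / r y" by linarith
      then show ?thesis using True j prob_later_score[OF u] by (simp add: ennreal_power)
    qed simp
  qed
  also have "\<dots> = ennreal (r y * (1 - (1 - 1 / R) ^ n) / n)"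
    using nn_integral_power_Icc[of "r y" "r y / R" "n - 1"] ry R1 r_div_R[OF y] j
    by (simp add: divide_le_eq)
  also have "ennreal (pmf P y) * \<dots> = ennreal (pmf Q y * (1 - (1 - 1 / R) ^ n) / n)"
    by (simp add: Q_eq[OF y, symmetric] ennreal_mult'[symmetric] mult_ac)
  finally show ?thesis .
qed

text \<open>Given score u, rival k contributes u * c and the other n - 2 samples contribute (1 -
  u)^(n - 2). Summed over j and k, the bounds give Q y * c, which is why \<open>overtaken\<close> is
  the relevant mean.\<close>

lemma emeasure_E_overtaken:
  assumes j: "j < n" and k: "k < n" "k \<noteq> j" and y: "y \<in> A"
  shows "emeasure W {\<omega>\<in>E j y. snd \<omega> k \<le> snd \<omega> j} \<le> ennreal (pmf Q y * overtaken A P Q y / (real n * real (n - 1)))"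
proof (cases "r y = 0")
  case True
  then show ?thesis using E_empty Q_eq[OF y] by simp
next
  case False
  then have ry: "r y > 0" using r_nonneg[of y] by simp
  let ?K = "{..<n} - {j}"
  let ?c = "overtaken A P Q y"
  have ev: "{\<omega>\<in>E j y. snd \<omega> k \<le> snd \<omega> j} \<in> sets W"
  proof -
    have "{\<omega>\<in>E j y. snd \<omega> k \<le> snd \<omega> j} = E j y \<inter> {\<omega>\<in>space W. snd \<omega> k \<le> snd \<omega> j}" by (auto simp: E_def)
    then show ?thesis by simp
  qed
  have "emeasure W {\<omega>\<in>E j y. snd \<omega> k \<le> snd \<omega> j} = ennreal (pmf P y) * (\<integral>\<^sup>+s. (if s \<le> r y / R then 1 else 0) *
     (\<Prod>i\<in>?K. \<Sum>z\<in>A. ennreal (pmf P z) * emeasure unif01 {w. s / r y * r z < w \<and> (i = k \<longrightarrow> w \<le> s)}) \<partial>unif01)"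
    using j ry k
    by (intro emeasure_W_event[where j=j] y ev) (auto simp: E_def sel_def acc_def)
  also have "(\<integral>\<^sup>+s. (if s \<le> r y / R then 1 else 0) *
     (\<Prod>i\<in>?K. \<Sum>z\<in>A. ennreal (pmf P z) * emeasure unif01 {w. s / r y * r z < w \<and> (i = k \<longrightarrow> w \<le> s)}) \<partial>unif01)
     = (\<integral>\<^sup>+s. ennreal ?c * (ennreal (s / r y * (1 - s / r y) ^ (n - 2)) * indicator {..r y / R} s) \<partial>unif01)"
  proof (rule nn_integral_cong_AE, rule AE_mp[OF AE_unif01], rule AE_I2, rule impI)
    fix s :: real assume s: "s \<in> {0..1}"
    show "(if s \<le> r y / R then 1 else 0) *
     (\<Prod>i\<in>?K. \<Sum>z\<in>A. ennreal (pmf P z) * emeasure unif01 {w. s / r y * r z < w \<and> (i = k \<longrightarrow> w \<le> s)}) =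
      ennreal ?c * (ennreal (s / r y * (1 - s / r y) ^ (n - 2)) * indicator {..r y / R} s)"
    proof (cases "s \<le> r y / R")
      case True
      then have u: "0 \<le> s / r y" "s / r y \<le> 1 / R" using s ry R1 by (auto simp: field_simps)
      moreover have "1 / R \<le> 1" using R1 by simp
      ultimately have u1: "0 \<le> 1 - s / r y" by linarith
      have K: "?K = insert k (?K - {k})" using k by auto
      have card: "card (?K - {k}) = n - 2" using j k by simp
      have "(\<Prod>i\<in>?K. \<Sum>z\<in>A. ennreal (pmf P z) * emeasure unif01 {w. s / r y * r z < w \<and> (i = k \<longrightarrow> w \<le> s)}) =
        (\<Sum>z\<in>A. ennreal (pmf P z) * emeasure unif01 {w. s / r y * r z < w \<and> w \<le> s}) *
        (\<Prod>i\<in>?K - {k}. \<Sum>z\<in>A. ennreal (pmf P z) * emeasure unif01 {w. s / r y * r z < w})"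
        by (subst K, subst prod.insert) (auto intro!: arg_cong2[where f="(*)"] prod.cong)
      also have "(\<Sum>z\<in>A. ennreal (pmf P z) * emeasure unif01 {w. s / r y * r z < w \<and> w \<le> s}) = ennreal (s / r y * ?c)"
        using prob_overtaking[OF u(1), of y] ry s by simp
      also have "(\<Prod>i\<in>?K - {k}. \<Sum>z\<in>A. ennreal (pmf P z) * emeasure unif01 {w. s / r y * r z < w}) = ennreal ((1 - s / r y) ^ (n - 2))"
        using prob_later_score[OF u] u1 card by (simp add: ennreal_power)
      finally show ?thesis using True u u1 overtaken_nonneg[of A P Q y]
        by (simp add: ennreal_mult'[symmetric] ennreal_mult''[symmetric] mult_ac)
    qed simp
  qed
  also have "\<dots> = ennreal ?c * (\<integral>\<^sup>+s. ennreal (s / r y * (1 - s / r y) ^ (n - 2)) * indicator {..r y / R} s \<partial>unif01)"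
    by (intro nn_integral_cmult) (simp add: measurable_unif01)
  also have "\<dots> \<le> ennreal ?c * ennreal (r y / (real (n - 1) * real n))"
    using nn_integral_times_power_le[of "r y" "r y / R" "n - 2"] ry R1 r_div_R[OF y] n2
    by (intro mult_left_mono) (auto simp: divide_le_eq numeral_2_eq_2 Suc_diff_Suc)
  finally have "emeasure W {\<omega>\<in>E j y. snd \<omega> k \<le> snd \<omega> j} \<le> ennreal (pmf P y) * (ennreal ?c * ennreal (r y / (real (n - 1) * real n)))"
    by (simp add: mult_left_mono)
  also have "\<dots> = ennreal (pmf Q y * ?c / (real n * real (n - 1)))"
    using overtaken_nonneg[of A P Q y]
    by (simp add: Q_eq[OF y, symmetric] ennreal_mult'[symmetric] mult_ac)
  finally show ?thesis .
qed

text \<open>Plain rejection sampling: j failures of probability 1 - 1 / R each, then value y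
  accepted with probability P y * r y / R = Q y / R.\<close>

lemma emeasure_E_tail:
  assumes j: "j \<ge> n" and y: "y \<in> A"
  shows "emeasure W (E j y) = ennreal (pmf Q y * (1 - 1 / R) ^ j / R)"
proof (cases "r y = 0")
  case True
  then show ?thesis using E_empty Q_eq[OF y] by simp
next
  case False
  then have ry: "r y > 0" using r_nonneg[of y] by simp
  have rej: "(\<Sum>z\<in>A. ennreal (pmf P z) * emeasure unif01 {w. \<not> acc z w}) = ennreal (1 - 1 / R)"
  proof -
    \<comment> \<open>Rejection means a score above 1 / R. For r z = 0 the two sets differ, but both
      have measure 1.\<close>
    have "emeasure unif01 {w. \<not> acc z w} = emeasure unif01 {w. 1 / R * r z < w}" if "z \<in> A" for z
    proof (cases "r z = 0")
      case True
      have "emeasure unif01 {w::real. \<not> acc z w} = emeasure unif01 UNIV" using True by (simp add: acc_def)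
      also have "\<dots> = 1" by simp
      also have "\<dots> = emeasure unif01 {w. 1 / R * r z < w}"
        using emeasure_unif01_greater[of 0] True by (simp add: greaterThan_def)
      finally show ?thesis .
    next
      case False
      then show ?thesis using r_nonneg[of z] by (auto simp: acc_def not_le intro!: arg_cong[where f="emeasure unif01"])
    qed
    then show ?thesis using prob_later_score[of "1 / R"] R1 by simp
  qed
  have "emeasure W (E j y) = ennreal (pmf P y) * (\<integral>\<^sup>+s. (if s \<le> r y / R then 1 else 0) *
     (\<Prod>k\<in>{..<j}. \<Sum>z\<in>A. ennreal (pmf P z) * emeasure unif01 {w. \<not> acc z w}) \<partial>unif01)"
    using j ry
    by (intro emeasure_W_event[where j=j] y E_event) (auto simp: E_def sel_def acc_def)
  also have "(\<integral>\<^sup>+s. (if s \<le> r y / R then 1 else 0) *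
     (\<Prod>k\<in>{..<j}. \<Sum>z\<in>A. ennreal (pmf P z) * emeasure unif01 {w. \<not> acc z w}) \<partial>unif01)
     = (\<integral>\<^sup>+s. ennreal ((1 - 1 / R) ^ j) * indicator {..r y / R} s \<partial>unif01)"
    using R1 by (intro nn_integral_cong) (auto simp: rej ennreal_power indicator_def)
  also have "\<dots> = ennreal ((1 - 1 / R) ^ j) * ennreal (r y / R)"
    using emeasure_unif01_atMost[of "r y / R"] ry R1 r_div_R[OF y] by (subst nn_integral_cmult_indicator) auto
  also have "ennreal (pmf P y) * \<dots> = ennreal (pmf Q y * (1 - 1 / R) ^ j / R)"
    using R1 by (simp add: Q_eq[OF y, symmetric] ennreal_mult'[symmetric] ennreal_mult''[symmetric] r_nonneg mult_ac)
  finally show ?thesis .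
qed

section \<open>Arrival order and the simulated index\<close>

text \<open>A permutation of the indices, counted from 0: the block is listed by arrival time and
  all later indices stay fixed.\<close>

definition ord :: "(nat \<Rightarrow> real) \<Rightarrow> nat \<Rightarrow> nat" where
  "ord t i = (if i < n then sort_key t [0..<n] ! i else i)"

lemma ord_less: "i < n \<Longrightarrow> ord t i < n"
proof -
  assume "i < n"
  then have "sort_key t [0..<n] ! i \<in> set (sort_key t [0..<n])" by (intro nth_mem) simp
  then show ?thesis using \<open>i < n\<close> by (simp add: ord_def)
qed

lemma inj_ord: "inj (ord t)"
proof (rule injI)
  fix i j assume eq: "ord t i = ord t j"
  have *: "i = j" if "i < n" "j < n" using that eq nth_eq_iff_index_eq[of "sort_key t [0..<n]" i j] by (simp add: ord_def)
  show "i = j"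
    using eq * ord_less[of i t] ord_less[of j t] by (cases "i < n"; cases "j < n") (auto simp: ord_def)
qed

lemma surj_ord: "\<exists>i. ord t i = j"
proof (cases "j < n")
  case True
  then have "j \<in> set (sort_key t [0..<n])" by simp
  then show ?thesis unfolding in_set_conv_nth by (auto simp: ord_def)
next
  case False
  then show ?thesis by (auto simp: ord_def)
qed

text \<open>The i indices listed earlier arrive no later; ties can enlarge the set on the right,
  hence an inequality.\<close>

lemma ord_rank: "i < n \<Longrightarrow> i \<le> card {k\<in>{..<n} - {ord t i}. t k \<le> t (ord t i)}"
proof -
  assume i: "i < n"
  have s: "sorted (map t (sort_key t [0..<n]))" by simp
  have "card (ord t ` {..<i}) \<le> card {k\<in>{..<n} - {ord t i}. t k \<le> t (ord t i)}"
  proof (rule card_mono)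
    show "ord t ` {..<i} \<subseteq> {k\<in>{..<n} - {ord t i}. t k \<le> t (ord t i)}"
    proof safe
      fix m assume m: "m < i"
      show "ord t m < n" using m i ord_less by simp
      show "t (ord t m) \<le> t (ord t i)"
        using sorted_nth_mono[OF s, of m i] m i by (simp add: ord_def)
      show "ord t m = ord t i \<Longrightarrow> False" using injD[OF inj_ord] m by fastforce
    qed
  qed simp
  moreover have "card (ord t ` {..<i}) = i"
    by (simp add: card_image inj_on_subset[OF inj_ord])
  ultimately show ?thesis by simp
qed

lemma ord_measurable: "(\<lambda>t. ord t i) \<in> measurable ST (count_space UNIV)"
proof (cases "i < n")
  case True
  have "(\<lambda>t. sort_key t [0..<n] ! i) \<in> measurable ST (count_space UNIV)"
    by (rule measurable_compose[OF measurable_sort_key[OF ST_measurable]]) simp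
  then show ?thesis using True by (simp add: ord_def)
qed (simp add: ord_def)

lemma ord_W_measurable [measurable]: "(\<lambda>\<omega>. ord (snd \<omega>) i) \<in> measurable W (count_space UNIV)"
  unfolding W_def by (rule measurable_compose[OF measurable_snd ord_measurable])

text \<open>Positions count from 1 but \<open>ord\<close> counts from 0, hence the shift.\<close>

definition X :: "nat \<Rightarrow> (nat \<Rightarrow> 'a) \<times> (nat \<Rightarrow> real) \<Rightarrow> 'a" where
  "X i \<omega> = fst \<omega> (ord (snd \<omega>) (i - 1))"

text \<open>The position of the selected sample in arrival order. The default 1 covers the event
  that nothing is selected, which is null because the probabilities of the events
  \<open>E j y\<close> sum to 1.\<close>

definition J :: "(nat \<Rightarrow> 'a) \<times> (nat \<Rightarrow> real) \<Rightarrow> nat" where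
  "J \<omega> = (if \<exists>j. sel j \<omega> then Suc (LEAST i. sel (ord (snd \<omega>) i) \<omega>) else 1)"

lemma X_measurable [measurable]: "X i \<in> measurable W (count_space A)"
  unfolding X_def by (rule measurable_compose_countable[OF Y_measurable ord_W_measurable])

lemma sel_ord_measurable [measurable]: "Measurable.pred W (\<lambda>\<omega>. sel (ord (snd \<omega>) i) \<omega>)"
  by (rule measurable_compose_countable[OF sel_measurable ord_W_measurable])

lemma J_measurable [measurable]: "J \<in> measurable W (count_space UNIV)"
  unfolding J_def by measurable

lemma X_J_measurable: "(\<lambda>\<omega>. X (J \<omega>) \<omega>) \<in> measurable W (count_space A)"
  by (rule measurable_compose_countable[OF X_measurable J_measurable])

lemma ord_J: "sel j \<omega> \<Longrightarrow> ord (snd \<omega>) (J \<omega> - 1) = j"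
proof -
  assume j: "sel j \<omega>"
  obtain i where "ord (snd \<omega>) i = j" using surj_ord by blast
  with j have "sel (ord (snd \<omega>) i) \<omega>" by simp
  then have "sel (ord (snd \<omega>) (LEAST i. sel (ord (snd \<omega>) i) \<omega>)) \<omega>" by (rule LeastI)
  then have "sel (ord (snd \<omega>) (J \<omega> - 1)) \<omega>" using j by (auto simp: J_def)
  then show ?thesis using j sel_unique by blast
qed

lemma X_J: "sel j \<omega> \<Longrightarrow> X (J \<omega>) \<omega> = fst \<omega> j"
  using ord_J[of j \<omega>] by (simp add: X_def)

lemma J_ge_1: "J \<omega> \<ge> 1" by (simp add: J_def)

text \<open>For fixed times the reordering is an injective reindexing of i.i.d. samples, which
  preserves their product law. The times are independent of the samples, so averaging over them
  preserves it too.\<close>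

lemma distr_X: "distr W (\<Pi>\<^sub>M i\<in>{1..}. NP) (\<lambda>\<omega>. \<lambda>i\<in>{1..}. X i \<omega>) = (\<Pi>\<^sub>M i\<in>{1..}. NP)"
proof (rule measure_eqI)
  let ?N = "\<Pi>\<^sub>M i\<in>{1::nat..}. NP"
  let ?f = "\<lambda>\<omega>. \<lambda>i\<in>{1..}. X i \<omega>"
  have f: "?f \<in> measurable W ?N"
    by (rule measurable_restrict) (simp add: measurable_cong_sets[OF refl sets_NP])
  have f': "?f \<in> measurable (SY \<Otimes>\<^sub>M ST) ?N" using f by (simp add: W_def)
  fix B assume "B \<in> sets (distr W ?N ?f)"
  then have B: "B \<in> sets ?N" by simp
  have "emeasure (distr W ?N ?f) B = emeasure (SY \<Otimes>\<^sub>M ST) (?f -` B \<inter> space (SY \<Otimes>\<^sub>M ST))"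
    using emeasure_distr[OF f' B] by (simp add: W_def)
  also have "\<dots> = (\<integral>\<^sup>+t. emeasure SY ((\<lambda>Y. (Y, t)) -` (?f -` B \<inter> space (SY \<Otimes>\<^sub>M ST))) \<partial>ST)"
    by (rule SYT.emeasure_pair_measure_alt2[OF measurable_sets[OF f' B]])
  also have "\<dots> = (\<integral>\<^sup>+t. emeasure ?N B \<partial>ST)"
  proof (rule nn_integral_cong)
    fix t assume t: "t \<in> space ST"
    let ?g = "\<lambda>Y. \<lambda>i\<in>{1::nat..}. Y (ord t (i - 1))"
    have "distr SY ?N ?g = ?N"
      unfolding SY_def
    proof (rule distr_PiM_reindex)
      show "inj_on (\<lambda>i. ord t (i - 1)) {1..}"
      proof (rule inj_onI)
        fix i j :: nat assume "i \<in> {1..}" "j \<in> {1..}" "ord t (i - 1) = ord t (j - 1)"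
        then show "i = j" using injD[OF inj_ord, of t "i - 1" "j - 1"] by auto
      qed
    qed (auto intro: prob_space_NP)
    then have "emeasure ?N B = emeasure (distr SY ?N ?g) B" by simp
    also have "\<dots> = emeasure SY (?g -` B \<inter> space SY)"
      using B by (intro emeasure_distr) (auto simp: SY_def intro!: measurable_restrict measurable_component_singleton)
    also have "?g -` B \<inter> space SY = (\<lambda>Y. (Y, t)) -` (?f -` B \<inter> space (SY \<Otimes>\<^sub>M ST))"
      using t by (auto simp: space_pair_measure X_def)
    finally show "emeasure SY ((\<lambda>Y. (Y, t)) -` (?f -` B \<inter> space (SY \<Otimes>\<^sub>M ST))) = emeasure ?N B" ..
  qed
  also have "\<dots> = emeasure ?N B" by (simp add: ST.emeasure_space_1)
  finally show "emeasure (distr W ?N ?f) B = emeasure ?N B" .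
qed simp

lemma distr_X_single: "i \<ge> 1 \<Longrightarrow> distr W NP (X i) = NP"
proof -
  assume i: "i \<ge> 1"
  let ?N = "\<Pi>\<^sub>M i\<in>{1::nat..}. NP"
  have f: "(\<lambda>\<omega>. \<lambda>i\<in>{1..}. X i \<omega>) \<in> measurable W ?N"
    by (rule measurable_restrict) (simp add: measurable_cong_sets[OF refl sets_NP])
  have "NP = distr ?N NP (\<lambda>x. x i)" using i by (intro distr_PiM_component[symmetric] prob_space_NP) auto
  also have "\<dots> = distr (distr W ?N (\<lambda>\<omega>. \<lambda>i\<in>{1..}. X i \<omega>)) NP (\<lambda>x. x i)" by (simp only: distr_X)
  also have "\<dots> = distr W NP (X i)"
    using i f by (subst distr_distr) (auto simp: comp_def intro!: distr_cong measurable_component_singleton)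
  finally show ?thesis ..
qed

lemma distr_count_space_A: "distr W (count_space A) f = distr W NP f"
  by (rule distr_cong) (auto simp: sets_NP)

lemma indep_vars_X: "W.indep_vars (\<lambda>_. count_space A) X {1..}"
proof (subst W.indep_vars_iff_distr_eq_PiM')
  have "distr W (\<Pi>\<^sub>M i\<in>{1..}. count_space A) (\<lambda>\<omega>. \<lambda>i\<in>{1..}. X i \<omega>) =
      distr W (\<Pi>\<^sub>M i\<in>{1..}. NP) (\<lambda>\<omega>. \<lambda>i\<in>{1..}. X i \<omega>)"
    by (intro distr_cong sets_PiM_cong) (auto simp: sets_NP)
  also have "\<dots> = (\<Pi>\<^sub>M i\<in>{1..}. NP)" by (rule distr_X)
  also have "\<dots> = (\<Pi>\<^sub>M i\<in>{1..}. distr W (count_space A) (X i))"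
    by (intro PiM_cong refl) (simp add: distr_count_space_A distr_X_single)
  finally show "distr W (\<Pi>\<^sub>M i\<in>{1..}. count_space A) (\<lambda>\<omega>. \<lambda>i\<in>{1..}. X i \<omega>) =
    (\<Pi>\<^sub>M i\<in>{1..}. distr W (count_space A) (X i))" .
qed auto

lemma prob_X:
  assumes "i \<ge> 1" "x \<in> A"
  shows "W.prob {\<omega>\<in>space W. X i \<omega> = x} = pmf P x"
proof -
  have "emeasure (distr W NP (X i)) {x} = emeasure W (X i -` {x} \<inter> space W)"
    using assms by (intro emeasure_distr) (auto simp: sets_NP measurable_cong_sets[OF refl sets_NP])
  also have "X i -` {x} \<inter> space W = {\<omega>\<in>space W. X i \<omega> = x}" by auto
  finally have "emeasure W {\<omega>\<in>space W. X i \<omega> = x} = ennreal (pmf P x)"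
    unfolding distr_X_single[OF assms(1)] using assms finA by (simp add: NP_def emeasure_point_measure_finite)
  then show ?thesis by (simp add: measure_def)
qed

section \<open>Law of the selected value\<close>

lemma suminf_tail: "(\<lambda>i. (1 - 1 / R) ^ (i + n) / R) sums (1 - 1 / R) ^ n"
proof -
  have "(\<lambda>i. (1 - 1 / R) ^ i) sums (1 / (1 - (1 - 1 / R)))"
    using R1 by (intro geometric_sums) auto
  from sums_mult[OF this, of "(1 - 1 / R) ^ n / R"] show ?thesis
    using R1 by (simp add: power_add mult_ac)
qed

text \<open>With q = 1 - 1 / R, the block contributes Q y (1 - q^n) and the rejection phase Q y q^n.
  Only a lower bound at this point, since the default index might output y as well.\<close>

lemma prob_X_J_ge:
  assumes y: "y \<in> A"
  shows "pmf Q y \<le> W.prob {\<omega>\<in>space W. X (J \<omega>) \<omega> = y}"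
proof -
  let ?q = "1 - 1 / R"
  have q: "0 \<le> ?q" "?q \<le> 1" using R1 by auto
  have disj: "disjoint_family (\<lambda>j. E j y)"
    using sel_unique by (auto simp: disjoint_family_on_def E_def)
  have ev: "{\<omega>\<in>space W. X (J \<omega>) \<omega> = y} \<in> sets W"
  proof -
    have "{\<omega>\<in>space W. X (J \<omega>) \<omega> = y} = (\<lambda>\<omega>. X (J \<omega>) \<omega>) -` {y} \<inter> space W" by auto
    then show ?thesis using measurable_sets[OF X_J_measurable, of "{y}"] y by simp
  qed
  have "ennreal (pmf Q y) = ennreal (pmf Q y * (1 - ?q ^ n)) + ennreal (pmf Q y * ?q ^ n)"
    using power_le_one[OF q] q by (subst ennreal_plus[symmetric]) (auto simp: algebra_simps simp flip: distrib_left intro!: mult_left_le)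
  also have "ennreal (pmf Q y * (1 - ?q ^ n)) = (\<Sum>j<n. emeasure W (E j y))"
  proof -
    have "(\<Sum>j<n. emeasure W (E j y)) = (\<Sum>j<n. ennreal (pmf Q y * (1 - ?q ^ n) / n))"
      by (intro sum.cong) (auto simp: emeasure_E_block y)
    also have "\<dots> = ennreal (\<Sum>j<n. pmf Q y * (1 - ?q ^ n) / n)"
      using q by (intro sum_ennreal) (auto simp: power_le_one)
    finally show ?thesis using n2 by simp
  qed
  also have "ennreal (pmf Q y * ?q ^ n) = (\<Sum>i. emeasure W (E (i + n) y))"
  proof -
    have "(\<lambda>i. pmf Q y * (?q ^ (i + n) / R)) sums (pmf Q y * ?q ^ n)"
      by (rule sums_mult[OF suminf_tail])
    then have "(\<Sum>i. ennreal (pmf Q y * (?q ^ (i + n) / R))) = ennreal (pmf Q y * ?q ^ n)"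
      using q R1 by (intro suminf_ennreal_eq) auto
    then show ?thesis by (simp add: emeasure_E_tail y)
  qed
  also have "(\<Sum>j<n. emeasure W (E j y)) + (\<Sum>i. emeasure W (E (i + n) y)) = (\<Sum>j. emeasure W (E j y))"
    by (subst suminf_offset[of _ n]) (auto simp: add.commute)
  also have "\<dots> = emeasure W (\<Union>j. E j y)"
    using disj by (intro suminf_emeasure) auto
  also have "\<dots> \<le> emeasure W {\<omega>\<in>space W. X (J \<omega>) \<omega> = y}"
    using X_J ev by (intro emeasure_mono) (auto simp: E_def)
  finally show ?thesis by (simp add: W.emeasure_eq_measure)
qed

text \<open>The probabilities sum to at most 1, their lower bounds Q y to exactly 1, so no bound is
  strict.\<close>

lemma prob_X_J:
  assumes y: "y \<in> A"
  shows "W.prob {\<omega>\<in>space W. X (J \<omega>) \<omega> = y} = pmf Q y"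
proof -
  let ?p = "\<lambda>y. W.prob {\<omega>\<in>space W. X (J \<omega>) \<omega> = y}"
  have ev: "{\<omega>\<in>space W. X (J \<omega>) \<omega> = z} \<in> sets W" if "z \<in> A" for z
  proof -
    have "{\<omega>\<in>space W. X (J \<omega>) \<omega> = z} = (\<lambda>\<omega>. X (J \<omega>) \<omega>) -` {z} \<inter> space W" by auto
    then show ?thesis using measurable_sets[OF X_J_measurable, of "{z}"] that by simp
  qed
  have "(\<Sum>z\<in>A. ?p z) = W.prob (\<Union>z\<in>A. {\<omega>\<in>space W. X (J \<omega>) \<omega> = z})"
    using finA ev by (intro W.finite_measure_finite_Union[symmetric]) (auto simp: disjoint_family_on_def)
  also have "\<dots> \<le> 1" by (rule W.prob_le_1)
  finally have "(\<Sum>z\<in>A. ?p z - pmf Q z) \<le> 0" by (simp add: sum_subtractf sum_Q)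
  moreover have "0 \<le> (\<Sum>z\<in>A. ?p z - pmf Q z)" using prob_X_J_ge by (intro sum_nonneg) auto
  ultimately have "(\<Sum>z\<in>A. ?p z - pmf Q z) = 0" by simp
  then have "?p y - pmf Q y = 0"
    using prob_X_J_ge finA y by (subst (asm) sum_nonneg_eq_0_iff) auto
  then show ?thesis by simp
qed

section \<open>Expected logarithm of the index\<close>

lemma rank_J:
  assumes "sel j \<omega>" "j < n"
  shows "J \<omega> \<le> 1 + card {k\<in>{..<n} - {j}. snd \<omega> k \<le> snd \<omega> j}"
proof -
  have oj: "ord (snd \<omega>) (J \<omega> - 1) = j" using assms(1) by (rule ord_J)
  have "J \<omega> - 1 < n" using oj assms(2) by (auto simp: ord_def split: if_splits)
  from ord_rank[OF this, of "snd \<omega>"] show ?thesis unfolding oj by linarith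
qed

lemma J_tail:
  assumes "sel j \<omega>" "j \<ge> n"
  shows "J \<omega> = Suc j"
proof -
  have oj: "ord (snd \<omega>) (J \<omega> - 1) = j" using assms(1) by (rule ord_J)
  have "\<not> J \<omega> - 1 < n" using oj assms(2) ord_less[of "J \<omega> - 1" "snd \<omega>"] by auto
  then show ?thesis using oj J_ge_1[of \<omega>] by (simp add: ord_def)
qed

text \<open>Jensen's inequality in tangent form: for each selected value y the logarithm is replaced
  by a line, so only the selection probabilities and the mean number of earlier arrivals are needed.
  The series is the cost of the rejection phase, where \<open>J\<close> = i + n + 1.\<close>

lemma expected_log_W:
  assumes summ: "summable (\<lambda>i. log 2 (real (Suc (i + n))) * ((1 - 1 / R) ^ (i + n) / R))"
  shows "expected_log W J \<le> ereal ((\<Sum>y\<in>A. pmf Q y * log 2 (1 + overtaken A P Q y)) +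
     (\<Sum>i. log 2 (real (Suc (i + n))) * ((1 - 1 / R) ^ (i + n) / R)))"
proof -
  let ?q = "1 - 1 / R"
  have q: "0 \<le> ?q" "?q \<le> 1" using R1 by auto
  define c where "c y = overtaken A P Q y" for y
  \<comment> \<open>Slope \<open>b\<close> and intercept \<open>a\<close> of the tangent to log_2 (1
    + x) at x = c y.\<close>
  define b where "b y = 1 / ((1 + c y) * ln 2)" for y
  define a where "a y = log 2 (1 + c y) - b y * c y" for y
  define L where "L i = log 2 (real (Suc (i + n)))" for i
  define D where "D j k y = {\<omega>\<in>E j y. snd \<omega> k \<le> snd \<omega> j}" for j k y
  have D_event [measurable]: "D j k y \<in> sets W" for j k y
  proof -
    have "D j k y = E j y \<inter> {\<omega>\<in>space W. snd \<omega> k \<le> snd \<omega> j}" by (auto simp: D_def E_def)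
    then show ?thesis by simp
  qed
  have c0: "c y \<ge> 0" for y using overtaken_nonneg by (simp add: c_def)
  have lc0: "log 2 (1 + c y) \<ge> 0" for y using c0[of y] by simp
  have b0: "b y \<ge> 0" for y using c0[of y] by (simp add: b_def)
  have tangent: "log 2 (1 + x) \<le> a y + b y * x" if "x \<ge> 0" for x y
  proof -
    have "ln ((1 + x) / (1 + c y)) \<le> (1 + x) / (1 + c y) - 1"
      using that c0[of y] by (intro ln_le_minus_one) (auto intro!: divide_pos_pos)
    moreover have "(1 + x) / (1 + c y) - 1 = (x - c y) / (1 + c y)"
      using c0[of y] by (simp add: field_simps)
    moreover have "ln ((1 + x) / (1 + c y)) = ln (1 + x) - ln (1 + c y)"
      using that c0[of y] by (intro ln_divide_pos) auto
    ultimately have "ln (1 + x) \<le> ln (1 + c y) + (x - c y) / (1 + c y)" by linarith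
    then have "ln (1 + x) / ln 2 \<le> (ln (1 + c y) + (x - c y) / (1 + c y)) / ln 2"
      by (intro divide_right_mono) auto
    then show ?thesis by (simp add: a_def b_def log_def add_divide_distrib diff_divide_distrib)
  qed
  have a0: "a y \<ge> 0" for y using tangent[of 0 y] by simp
  have L0: "L i \<ge> 0" for i by (simp add: L_def)
  \<comment> \<open>\<open>F\<close> is the tangent line evaluated at the number of earlier
    arrivals, written as a sum of indicators of \<open>D\<close>; \<open>G\<close> covers selection
    beyond the block.\<close>
  define F where "F j y \<omega> = ennreal (a y) * indicator (E j y) \<omega> + (\<Sum>k\<in>{..<n} - {j}. ennreal (b y) * indicator (D j k y) \<omega>)" for j y \<omega>
  define G where "G i \<omega> = (\<Sum>y\<in>A. ennreal (L i) * indicator (E (i + n) y) \<omega>)" for i \<omega>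
  have [measurable]: "F j y \<in> borel_measurable W" "G i \<in> borel_measurable W" for j y i
    unfolding F_def G_def by measurable
  have pointwise: "ennreal (log 2 (J \<omega>)) \<le> (\<Sum>j<n. \<Sum>y\<in>A. F j y \<omega>) + (\<Sum>i. G i \<omega>)"
    if w: "\<omega> \<in> space W" for \<omega>
  proof (cases "\<exists>j. sel j \<omega>")
    case False
    then show ?thesis by (simp add: J_def)
  next
    case True
    then obtain j where j: "sel j \<omega>" by blast
    define y where "y = fst \<omega> j"
    have y: "y \<in> A" using Y_space[OF w] by (simp add: y_def)
    have E: "\<omega> \<in> E j y" using j w by (simp add: E_def y_def)
    show ?thesis
    proof (cases "j < n")
      case True
      let ?C = "{k\<in>{..<n} - {j}. snd \<omega> k \<le> snd \<omega> j}"
      have "log 2 (J \<omega>) \<le> log 2 (1 + card ?C)"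
        using rank_J[OF j True] J_ge_1[of \<omega>] by (intro log_mono) (auto simp del: of_nat_Suc)
      also have "\<dots> \<le> a y + b y * card ?C" using tangent[of "card ?C" y] by simp
      finally have "ennreal (log 2 (J \<omega>)) \<le> ennreal (a y + b y * card ?C)" by (rule ennreal_leI)
      also have "\<dots> = ennreal (a y) + ennreal (b y) * card ?C"
        using a0 b0 by (simp add: ennreal_mult ennreal_of_nat_eq_real_of_nat)
      also have "ennreal (b y) * card ?C = (\<Sum>k\<in>{..<n} - {j}. ennreal (b y) * indicator (D j k y) \<omega>)"
      proof -
        have "(\<Sum>k\<in>{..<n} - {j}. ennreal (b y) * indicator (D j k y) \<omega>) = (\<Sum>k\<in>?C. ennreal (b y))"
          using E by (intro sum.mono_neutral_cong_right) (auto simp: D_def indicator_def)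
        then show ?thesis by (simp add: mult.commute)
      qed
      also have "ennreal (a y) + \<dots> = F j y \<omega>" using E by (simp add: F_def)
      also have "\<dots> \<le> (\<Sum>y\<in>A. F j y \<omega>)" using y finA by (intro member_le_sum) auto
      also have "\<dots> \<le> (\<Sum>j<n. \<Sum>y\<in>A. F j y \<omega>)"
        using True by (intro member_le_sum[of j "{..<n}" "\<lambda>j. \<Sum>y\<in>A. F j y \<omega>"]) auto
      also have "\<dots> \<le> (\<Sum>j<n. \<Sum>y\<in>A. F j y \<omega>) + (\<Sum>i. G i \<omega>)" by (rule add_increasing2) auto
      finally show ?thesis .
    next
      case False
      then have jn: "j = (j - n) + n" by simp
      have "ennreal (log 2 (J \<omega>)) = ennreal (L (j - n)) * indicator (E (j - n + n) y) \<omega>"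
        using J_tail[OF j] False E by (simp add: L_def)
      also have "\<dots> \<le> G (j - n) \<omega>" unfolding G_def
        by (rule member_le_sum[OF y, of "\<lambda>y. ennreal (L (j - n)) * indicator (E (j - n + n) y) \<omega>"]) (use finA in auto)
      also have "\<dots> \<le> (\<Sum>i. G i \<omega>)" by (rule ennreal_le_suminf)
      also have "\<dots> \<le> (\<Sum>j<n. \<Sum>y\<in>A. F j y \<omega>) + (\<Sum>i. G i \<omega>)" by (rule add_increasing) auto
      finally show ?thesis .
    qed
  qed
  have intF: "(\<integral>\<^sup>+\<omega>. F j y \<omega> \<partial>W) \<le> ennreal (pmf Q y * log 2 (1 + c y) / n)" if "j < n" "y \<in> A" for j y
  proof -
    have "(\<integral>\<^sup>+\<omega>. F j y \<omega> \<partial>W) = ennreal (a y) * emeasure W (E j y) + (\<Sum>k\<in>{..<n} - {j}. ennreal (b y) * emeasure W (D j k y))"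
    proof -
      have "(\<integral>\<^sup>+\<omega>. F j y \<omega> \<partial>W) = (\<integral>\<^sup>+\<omega>. ennreal (a y) * indicator (E j y) \<omega> \<partial>W) +
        (\<integral>\<^sup>+\<omega>. (\<Sum>k\<in>{..<n} - {j}. ennreal (b y) * indicator (D j k y) \<omega>) \<partial>W)"
        unfolding F_def by (rule nn_integral_add) measurable
      also have "(\<integral>\<^sup>+\<omega>. (\<Sum>k\<in>{..<n} - {j}. ennreal (b y) * indicator (D j k y) \<omega>) \<partial>W) =
        (\<Sum>k\<in>{..<n} - {j}. \<integral>\<^sup>+\<omega>. ennreal (b y) * indicator (D j k y) \<omega> \<partial>W)"
        by (rule nn_integral_sum) measurable
      finally show ?thesis by (simp add: nn_integral_cmult_indicator)
    qed
    also have "\<dots> \<le> ennreal (a y) * ennreal (pmf Q y / n) +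
       (\<Sum>k\<in>{..<n} - {j}. ennreal (b y) * ennreal (pmf Q y * c y / (real n * real (n - 1))))"
    proof (intro add_mono sum_mono mult_left_mono)
      have "pmf Q y * (1 - ?q ^ n) / n \<le> pmf Q y / n"
        using q by (intro divide_right_mono mult_left_le) auto
      then show "emeasure W (E j y) \<le> ennreal (pmf Q y / n)"
        unfolding emeasure_E_block[OF that] by (rule ennreal_leI)
      show "emeasure W (D j k y) \<le> ennreal (pmf Q y * c y / (real n * real (n - 1)))" if "k \<in> {..<n} - {j}" for k
        using emeasure_E_overtaken[OF \<open>j < n\<close> _ _ \<open>y \<in> A\<close>, of k] that by (simp add: D_def c_def)
    qed auto
    also have "\<dots> = ennreal (a y * (pmf Q y / n) + real (n - 1) * (b y * (pmf Q y * c y / (real n * real (n - 1)))))"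
    proof -
      have "ennreal (a y) * ennreal v + (\<Sum>k\<in>{..<n} - {j}. ennreal (b y) * ennreal w) =
         ennreal (a y * v + real (n - 1) * (b y * w))" if "v \<ge> 0" "w \<ge> 0" for v w
        using a0 b0 \<open>j < n\<close> that
        by (simp add: ennreal_mult ennreal_of_nat_eq_real_of_nat del: of_nat_diff)
      then show ?thesis by this (use c0 in auto)
    qed
    also have "real (n - 1) * (b y * (pmf Q y * c y / (real n * real (n - 1)))) = b y * (pmf Q y * c y / n)"
      using n2 by simp
    \<comment> \<open>The tangent touches at c y: a y + b y * c y = log_2 (1 + c y).\<close>
    also have "a y * (pmf Q y / n) + b y * (pmf Q y * c y / n) = pmf Q y * log 2 (1 + c y) / n"
      by (simp add: a_def algebra_simps diff_divide_distrib)
    finally show ?thesis .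
  qed
  have intG: "(\<integral>\<^sup>+\<omega>. G i \<omega> \<partial>W) = ennreal (L i * (?q ^ (i + n) / R))" for i
  proof -
    have "(\<integral>\<^sup>+\<omega>. G i \<omega> \<partial>W) = (\<Sum>y\<in>A. ennreal (L i) * emeasure W (E (i + n) y))"
      unfolding G_def by (subst nn_integral_sum) (auto simp: nn_integral_cmult_indicator)
    also have "\<dots> = (\<Sum>y\<in>A. ennreal (pmf Q y * (L i * (?q ^ (i + n) / R))))"
      using L0[of i] by (intro sum.cong) (auto simp: emeasure_E_tail ennreal_mult'[symmetric] mult_ac)
    also have "\<dots> = ennreal (\<Sum>y\<in>A. pmf Q y * (L i * (?q ^ (i + n) / R)))"
      using L0[of i] q R1 by (intro sum_ennreal) auto
    also have "(\<Sum>y\<in>A. pmf Q y * (L i * (?q ^ (i + n) / R))) = L i * (?q ^ (i + n) / R)"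
      by (simp only: sum_distrib_right[symmetric] sum_Q mult_1)
    finally show ?thesis .
  qed
  have "(\<integral>\<^sup>+\<omega>. ennreal (log 2 (J \<omega>)) \<partial>W) \<le> (\<integral>\<^sup>+\<omega>. (\<Sum>j<n. \<Sum>y\<in>A. F j y \<omega>) + (\<Sum>i. G i \<omega>) \<partial>W)"
    by (intro nn_integral_mono pointwise)
  also have "\<dots> = (\<Sum>j<n. \<Sum>y\<in>A. \<integral>\<^sup>+\<omega>. F j y \<omega> \<partial>W) + (\<Sum>i. \<integral>\<^sup>+\<omega>. G i \<omega> \<partial>W)"
    by (simp add: nn_integral_add nn_integral_sum nn_integral_suminf)
  also have "\<dots> \<le> (\<Sum>j<n. \<Sum>y\<in>A. ennreal (pmf Q y * log 2 (1 + c y) / n)) + (\<Sum>i. ennreal (L i * (?q ^ (i + n) / R)))"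
    using intF by (intro add_mono sum_mono) (auto simp: intG)
  also have "(\<Sum>j<n. \<Sum>y\<in>A. ennreal (pmf Q y * log 2 (1 + c y) / n)) = ennreal (\<Sum>y\<in>A. pmf Q y * log 2 (1 + c y))"
  proof -
    have "(\<Sum>j<n. \<Sum>y\<in>A. ennreal (pmf Q y * log 2 (1 + c y) / n)) = (\<Sum>j<n. ennreal (\<Sum>y\<in>A. pmf Q y * log 2 (1 + c y) / n))"
      using lc0 by (intro sum.cong sum_ennreal refl) auto
    also have "\<dots> = ennreal (\<Sum>j<n. \<Sum>y\<in>A. pmf Q y * log 2 (1 + c y) / n)"
      using lc0 by (intro sum_ennreal sum_nonneg) auto
    also have "(\<Sum>j<n. \<Sum>y\<in>A. pmf Q y * log 2 (1 + c y) / n) = (\<Sum>y\<in>A. pmf Q y * log 2 (1 + c y))"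
      using n2 by (simp add: sum_divide_distrib[symmetric])
    finally show ?thesis .
  qed
  also have "(\<Sum>i. ennreal (L i * (?q ^ (i + n) / R))) = ennreal (\<Sum>i. L i * (?q ^ (i + n) / R))"
    using summ L0 q R1 by (intro suminf_ennreal2) (auto simp: L_def)
  also have "ennreal (\<Sum>y\<in>A. pmf Q y * log 2 (1 + c y)) + ennreal (\<Sum>i. L i * (?q ^ (i + n) / R)) =
    ennreal ((\<Sum>y\<in>A. pmf Q y * log 2 (1 + c y)) + (\<Sum>i. L i * (?q ^ (i + n) / R)))"
    using summ L0 q R1 lc0 by (intro ennreal_plus[symmetric] sum_nonneg suminf_nonneg) (auto simp: L_def)
  finally have le: "(\<integral>\<^sup>+\<omega>. ennreal (log 2 (J \<omega>)) \<partial>W) \<le> \<dots>" .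
  have nn: "0 \<le> (\<Sum>y\<in>A. pmf Q y * log 2 (1 + c y)) + (\<Sum>i. L i * (?q ^ (i + n) / R))"
    using summ L0 q R1 lc0 by (intro add_nonneg_nonneg sum_nonneg suminf_nonneg) (auto simp: L_def)
  have "expected_log W J \<le> enn2ereal (ennreal ((\<Sum>y\<in>A. pmf Q y * log 2 (1 + c y)) + (\<Sum>i. L i * (?q ^ (i + n) / R))))"
    unfolding expected_log_def less_eq_ennreal.rep_eq[symmetric] by (rule le)
  also have "\<dots> = ereal ((\<Sum>y\<in>A. pmf Q y * log 2 (1 + c y)) + (\<Sum>i. L i * (?q ^ (i + n) / R)))"
    using nn by (rule enn2ereal_ennreal)
  finally show ?thesis unfolding c_def L_def .
qed

lemma simulator_W: "simulator A P Q W X J"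
  unfolding simulator_def
  using W.prob_space_axioms indep_vars_X prob_X J_measurable J_ge_1 prob_X_J by auto

end

section \<open>The simulator\<close>

text \<open>Moves the race to a measure of the type demanded by the theorem. The map
  \<open>T\<close> records the samples and stores the index in every real component; pushing forward
  along it preserves all relevant laws.\<close>

lemma simulator_transport:
  fixes N :: "'w measure" and A :: "'a set"
  assumes "simulator A P Q N X J"
  shows "\<exists>(M :: (nat \<Rightarrow> 'a \<times> real) measure) X' J'.
     simulator A P Q M X' J' \<and> expected_log M J' = expected_log N J"
proof -
  interpret N: prob_space N using assms by (simp add: simulator_def)
  let ?S = "\<Pi>\<^sub>M i\<in>UNIV::nat set. count_space A \<Otimes>\<^sub>M (borel :: real measure)"
  \<comment> \<open>\<open>X 0\<close> need not be measurable, so component 0 repeats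
    \<open>X 1\<close>.\<close>
  define T where "T \<omega> = (\<lambda>i::nat. (X (max 1 i) \<omega>, real (J \<omega>)))" for \<omega>
  define X' where "X' i w = fst (w i :: 'a \<times> real)" for i :: nat and w
  \<comment> \<open>The outer maximum makes \<open>J'\<close> \<ge> 1 on the whole space, also
    outside the image of \<open>T\<close>.\<close>
  define J' where "J' w = max 1 (nat \<lfloor>snd (w 0 :: 'a \<times> real)\<rfloor>)" for w :: "nat \<Rightarrow> 'a \<times> real"
  define M where "M = distr N ?S T"
  have X: "X i \<in> measurable N (count_space A)" if "i \<ge> 1" for i
    using assms that by (auto simp: simulator_def N.indep_vars_def)
  have J [measurable]: "J \<in> measurable N (count_space UNIV)" using assms by (simp add: simulator_def)
  have J1: "J \<omega> \<ge> 1" if "\<omega> \<in> space N" for \<omega> using assms that by (simp add: simulator_def)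
  have T [measurable]: "T \<in> measurable N ?S"
    unfolding T_def
    by (rule measurable_PiM_single')
       (use X[THEN measurable_space] in \<open>auto intro!: measurable_Pair X simp: space_pair_measure PiE_iff\<close>)
  have X' [measurable]: "X' i \<in> measurable ?S (count_space A)" for i
    unfolding X'_def by measurable
  have X'M: "X' i \<in> measurable M (count_space A)" for i by (simp add: M_def)
  have J' [measurable]: "J' \<in> measurable ?S (count_space UNIV)"
    unfolding J'_def by measurable
  interpret M: prob_space M unfolding M_def by (rule N.prob_space_distr) simp
  have X'T: "X' i (T \<omega>) = X i \<omega>" if "i \<ge> 1" for i \<omega> using that by (simp add: X'_def T_def max_def)
  have J'T: "J' (T \<omega>) = J \<omega>" if "\<omega> \<in> space N" for \<omega> using J1[OF that] by (simp add: J'_def T_def)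
  have meas: "measure M {w \<in> space M. R w} = measure N {\<omega>\<in>space N. R (T \<omega>)}"
    if "Measurable.pred ?S R" for R
    using that measurable_space[OF T] unfolding M_def
    by (subst measure_distr) (auto simp: pred_def intro!: arg_cong[where f="measure N"])
  have ind: "M.indep_vars (\<lambda>_. count_space A) X' {1..}"
  proof -
    have "distr M (\<Pi>\<^sub>M i\<in>{1..}. count_space A) (\<lambda>w. \<lambda>i\<in>{1..}. X' i w) =
          distr N (\<Pi>\<^sub>M i\<in>{1..}. count_space A) (\<lambda>\<omega>. \<lambda>i\<in>{1..}. X i \<omega>)"
      unfolding M_def
      by (subst distr_distr) (auto intro!: distr_cong measurable_restrict simp: comp_def X'T)
    also have "\<dots> = (\<Pi>\<^sub>M i\<in>{1..}. distr N (count_space A) (X i))"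
      using assms X by (subst N.indep_vars_iff_distr_eq_PiM'[symmetric]) (auto simp: simulator_def)
    also have "\<dots> = (\<Pi>\<^sub>M i\<in>{1..}. distr M (count_space A) (X' i))"
      unfolding M_def
      by (intro PiM_cong refl, subst distr_distr) (auto intro!: distr_cong simp: comp_def X'T)
    finally show ?thesis
      by (subst M.indep_vars_iff_distr_eq_PiM') (auto simp: X'M)
  qed
  have Xeq: "Measurable.pred ?S (\<lambda>w. X' i w = x)" for i x
    by (rule measurable_compose[OF X']) simp
  have XJ: "Measurable.pred ?S (\<lambda>w. X' (J' w) w = x)" for x
    by (rule measurable_compose_countable[OF Xeq J'])
  have "simulator A P Q M X' J'"
    unfolding simulator_def
  proof (intro conjI ballI allI impI)
    fix i x assume "1 \<le> (i::nat)" "x \<in> A"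
    then show "measure M {w \<in> space M. X' i w = x} = pmf P x"
      using assms by (subst meas[OF Xeq]) (simp add: simulator_def X'T)
  next
    fix x assume "x \<in> A"
    have "{\<omega>\<in>space N. X' (J' (T \<omega>)) (T \<omega>) = x} = {\<omega>\<in>space N. X (J \<omega>) \<omega> = x}"
      using J'T X'T J1 by auto
    with \<open>x \<in> A\<close> show "measure M {w \<in> space M. X' (J' w) w = x} = pmf Q x"
      using assms by (subst meas[OF XJ]) (simp add: simulator_def)
  next
    show "J' \<in> measurable M (count_space UNIV)" by (simp add: M_def)
  qed (use ind in \<open>auto simp: J'_def M.prob_space_axioms\<close>)
  moreover have "expected_log M J' = expected_log N J"
    unfolding expected_log_def M_def
    by (subst nn_integral_distr) (auto intro!: nn_integral_cong arg_cong[where f=enn2ereal] simp: J'T)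
  ultimately show ?thesis by blast
qed

text \<open>Comparison with the differentiated geometric series, using log_2 (m + 1) \<le> m +
  1.\<close>

lemma summable_log_geometric:
  fixes q :: real
  assumes "0 \<le> q" "q < 1"
  shows "summable (\<lambda>m. log 2 (real (Suc m)) * (q ^ m / R))"
proof -
  have summable: "summable (\<lambda>m. real (Suc m) * q ^ m)"
    using geometric_deriv_sums[of q] assms by (simp add: sums_iff)
  have log_le: "log 2 (real (Suc m)) \<le> real (Suc m)" for m
  proof -
    have "real (Suc m) < 2 ^ Suc m" by (rule of_nat_less_two_power)
    then show ?thesis by (subst log_le_iff) (auto simp flip: powr_realpow simp del: of_nat_Suc power_Suc)
  qed
  have "summable (\<lambda>m. log 2 (real (Suc m)) * q ^ m)"
  proof (rule summable_comparison_test'[OF summable])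
    fix m :: nat
    have "log 2 (real (Suc m)) \<ge> 0" by simp
    then show "norm (log 2 (real (Suc m)) * q ^ m) \<le> real (Suc m) * q ^ m"
      using mult_right_mono[OF log_le, of "q ^ m" m] assms(1)
      by (simp only: real_norm_def abs_of_nonneg zero_le_power mult_nonneg_nonneg)
  qed
  from summable_divide[OF this, of R] show ?thesis by simp
qed

lemma simulator_expected_log_le:
  fixes A :: "'a set" and P Q :: "'a pmf"
  assumes A: "finite A" "set_pmf P \<subseteq> A" "set_pmf Q \<subseteq> A" and D: "kl_div A Q P < \<infinity>"
  shows "\<exists>(M :: (nat \<Rightarrow> 'a \<times> real) measure) X J. simulator A P Q M X J \<and>
    expected_log M J \<le> kl_div A Q P + ereal (1.45 * l1_dist A Q P)"
proof -
  have ac: "pmf Q x = 0" if "x \<in> A" "pmf P x = 0" for x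
    using D that by (auto simp: kl_div_def less_le split: if_splits)
  \<comment> \<open>The slack between 1.45 and log_2 e, as a budget for the rejection tail.\<close>
  define \<epsilon> where "\<epsilon> = (1.45 - 1 / ln 2) * l1_dist A Q P"
  have l1: "l1_dist A Q P \<ge> 0" unfolding l1_dist_def by (intro sum_nonneg) auto
  obtain R n where Rn: "R \<ge> 1" "\<And>x. x \<in> A \<Longrightarrow> pmf Q x \<le> R * pmf P x" "n \<ge> (2 :: nat)"
    and tail: "(\<Sum>i. log 2 (real (Suc (i + n))) * ((1 - 1 / R) ^ (i + n) / R)) \<le> \<epsilon>"
  proof (cases "l1_dist A Q P = 0")
    case True
    then have "pmf Q x = pmf P x" if "x \<in> A" for x
      using that A(1) unfolding l1_dist_def by (subst (asm) sum_nonneg_eq_0_iff) auto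
    \<comment> \<open>The budget is 0 here, but P and Q agree on \<open>A\<close>, so R = 1 is
      allowed. Then 1 - 1 / R = 0 and the tail vanishes.\<close>
    then show thesis by (intro that[of 1 2]) (auto simp: \<epsilon>_def True)
  next
    case False
    \<comment> \<open>A crude common bound for all ratios Q x / P x that is at least 1.\<close>
    define R where "R = 1 + (\<Sum>x\<in>A. pmf Q x / pmf P x)"
    have nn: "(\<Sum>x\<in>A. pmf Q x / pmf P x) \<ge> 0" by (intro sum_nonneg) auto
    have R: "R \<ge> 1" using nn by (simp add: R_def)
    have Q_le: "pmf Q x \<le> R * pmf P x" if "x \<in> A" for x
    proof (cases "pmf P x = 0")
      case True
      then show ?thesis using ac that by simp
    next
      case False
      have "pmf Q x / pmf P x \<le> (\<Sum>x\<in>A. pmf Q x / pmf P x)"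
        using that A(1) by (intro member_le_sum) auto
      then have "pmf Q x / pmf P x \<le> R" by (simp add: R_def)
      moreover have "pmf P x > 0" using False by (simp add: less_le)
      ultimately show ?thesis by (simp add: pos_divide_le_eq)
    qed
    have "\<epsilon> > 0" using False l1 inverse_ln_2_less by (simp add: \<epsilon>_def)
    moreover have "summable (\<lambda>m. log 2 (real (Suc m)) * ((1 - 1 / R) ^ m / R))"
      using R by (intro summable_log_geometric) auto
    ultimately obtain N where N: "\<And>n. n \<ge> N \<Longrightarrow> norm (\<Sum>i. log 2 (real (Suc (i + n))) * ((1 - 1 / R) ^ (i + n) / R)) < \<epsilon>"
      using suminf_exist_split by blast
    \<comment> \<open>\<open>n\<close> is taken so large that the tail of a convergent series fits
      the budget, and at least 2 as \<open>race\<close> requires.\<close>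
    show thesis using N[of "max N 2"] by (intro that[of R "max N 2"] R Q_le) auto
  qed
  interpret race A P Q R n using A Rn by unfold_locales auto
  have "summable (\<lambda>i. log 2 (real (Suc (i + n))) * ((1 - 1 / R) ^ (i + n) / R))"
    using summable_log_geometric[of "1 - 1 / R" R] Rn(1)
    by (subst summable_iff_shift[of "\<lambda>m. log 2 (real (Suc m)) * ((1 - 1 / R) ^ m / R)" n]) auto
  from expected_log_W[OF this] have "expected_log W J \<le> ereal ((\<Sum>y\<in>A. pmf Q y * log 2 (1 + overtaken A P Q y)) + \<epsilon>)"
    by (rule order_trans) (use tail in simp)
  also have "(\<Sum>y\<in>A. pmf Q y * log 2 (1 + overtaken A P Q y)) = (\<Sum>y\<in>A. pmf Q y * ln (1 + overtaken A P Q y)) / ln 2"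
    by (simp add: log_def sum_divide_distrib)
  also have "\<dots> + \<epsilon> \<le> ((\<Sum>y\<in>A. if pmf Q y = 0 then 0 else pmf Q y * ln (pmf Q y / pmf P y)) + l1_dist A Q P) / ln 2 + \<epsilon>"
    using sum_log_overtaken_le[OF A ac] by (intro add_right_mono divide_right_mono) auto
  also have "\<dots> = (\<Sum>y\<in>A. if pmf Q y = 0 then 0 else pmf Q y * log 2 (pmf Q y / pmf P y)) + 1.45 * l1_dist A Q P"
  proof -
    have "(\<Sum>y\<in>A. if pmf Q y = 0 then 0 else pmf Q y * log 2 (pmf Q y / pmf P y)) =
       (\<Sum>y\<in>A. if pmf Q y = 0 then 0 else pmf Q y * ln (pmf Q y / pmf P y)) / ln 2"
      unfolding sum_divide_distrib by (intro sum.cong) (auto simp: log_def)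
    then show ?thesis by (simp add: \<epsilon>_def add_divide_distrib left_diff_distrib)
  qed
  finally have "expected_log W J \<le> kl_div A Q P + ereal (1.45 * l1_dist A Q P)"
    using D by (auto simp: kl_div_def split: if_splits)
  with simulator_transport[OF simulator_W] show ?thesis by metis
qed

theorem mainTheorem1:
  fixes A :: "'a set" and P Q :: "'a pmf"
  assumes "finite A" and "set_pmf P \<subseteq> A" and "set_pmf Q \<subseteq> A"
  shows "(kl_div A Q P < \<infinity> \<longrightarrow>
            (\<exists>(M :: (nat \<Rightarrow> 'a \<times> real) measure) X J. simulator A P Q M X J \<and>
               expected_log M J \<le> kl_div A Q P + ereal (1.45 * l1_dist A Q P)))
       \<and> (\<forall>(M :: 'w measure) X J. simulator A P Q M X J \<longrightarrow>
            expected_log M J \<ge> ereal (1 / 2) * max (kl_div A Q P) (ereal (l1_dist A Q P)))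
       \<and> (kl_div A Q P = \<infinity> \<longrightarrow> \<not> (\<exists>(M :: 'w measure) X J. simulator A P Q M X J))"
proof (intro conjI impI allI notI)
  fix M :: "'w measure" and X J assume "simulator A P Q M X J"
  then interpret simulation A P Q M X J using assms(1) by unfold_locales
  show "ereal (1 / 2) * max (kl_div A Q P) (ereal (l1_dist A Q P)) \<le> expected_log M J"
    using half_kl_div_le_expected_log half_l1_dist_le_expected_log[OF assms(2,3)]
    by (auto simp: max_def)
next
  assume "kl_div A Q P = \<infinity>" "\<exists>(M :: 'w measure) X J. simulator A P Q M X J"
  then obtain M :: "'w measure" and X J where "simulator A P Q M X J" by blast
  then interpret simulation A P Q M X J using assms(1) by unfold_locales
  show False using kl_div_finite \<open>kl_div A Q P = \<infinity>\<close> by simp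
qed (use simulator_expected_log_le[OF assms] in blast)

end
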